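(* Let $k\geq 3$ be an integer, let $\varphi_k:M_{KT}\to\mathbb{CP}^{k^2-1}$ be the map of the Kodaira--Thurston manifold $M_{KT}=\mathbb{R}^4/\Gamma$ whose homogeneous coordinates are the $k^2$ functions $$\theta_k^p(z+ix,\,y+i)\cdot\theta_k^q(y+it,\,i),\qquad p,q=1,\ldots,k,$$ and let $\Omega$ be the Fubini--Study form on $\mathbb{CP}^{k^2-1}$. Then: 1. The induced form $\varphi_k^*\Omega$ is a symplectic form on $M_{KT}$. 2. The induced symplectic form $\varphi_k^*\Omega$ is cohomologous to $k\cdot\omega_{KT}$, i.e. $[\varphi_k^*\Omega]=k\,[\omega_{KT}]$ in $H^2(M_{KT};\mathbb{R})$, where $\omega_{KT}=(dz-x\,dy)\wedge dx+dy\wedge dt$.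
   Context: The Kodaira--Thurston manifold $M_{KT}$ is the quotient of $\mathbb{R}^4$, with coordinates $(x,y,z,t)$, by the free action of the discrete group $\Gamma$ generated by the diffeomorphisms $$a:(x,y,z,t)\mapsto(x+1,y,z+y,t),\quad b:(x,y,z,t)\mapsto(x,y+1,z,t),$$ $$c:(x,y,z,t)\mapsto(x,y,z+1,t),\quad d:(x,y,z,t)\mapsto(x,y,z,t+1).$$ It is a compact smooth 4-manifold. The 1-forms $dx,\ dy,\ dz-x\,dy,\ dt$ on $\mathbb{R}^4$ are $\Gamma$-invariant and so descend to $M_{KT}$; the form $\omega_{KT}=(dz-x\,dy)\wedge dx+dy\wedge dt$ is a symplectic form on $M_{KT}$. Classical theta functions: for $\tau\in\mathbb{C}$ with $\mathrm{Im}\,\tau>0$ and $k\in\mathbb{N}$, a classical theta function of degree $k$ is an entire function $w\mapsto\theta_k(w,\tau)$ satisfying $$\theta_k(w+1,\tau)=\theta_k(w,\tau),\qquad \theta_k(w+\tau,\tau)=\exp(-2\pi i k w)\,\theta_k(w,\tau).$$ For fixed $\tau$ these form a complex vector space of dimension $k$. Fix a family $\{\theta_k^p(w,\tau)\}_{p=1}^k$ of functions, holomorphic in $(w,\tau)\in\mathbb{C}\times\{\mathrm{Im}\,\tau>0\}$, such that for every $\tau$ the functions $\theta_k^1(\cdot,\tau),\ldots,\theta_k^k(\cdot,\tau)$ form a basis of this space, and such that $\theta_k^p(w,\tau+1)=\theta_k^p(w,\tau)$ for all $p$. (Such families exist, for example $\theta_k^p(w,\tau)=\sum_{m\in\mathbb{Z}}e^{2\pi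 i(p+km)w+\pi i(2pm+km(m-1))\tau}$.) The $k^2$ functions $(x,y,z,t)\mapsto\theta_k^p(z+ix,y+i)\cdot\theta_k^q(y+it,i)$ on $\mathbb{R}^4$ transform under each generator of $\Gamma$ by a common nowhere vanishing factor, so that, taken in any fixed order as homogeneous coordinates, they define the map $\varphi_k:M_{KT}\to\mathbb{CP}^{k^2-1}$. The Fubini--Study form on $\mathbb{CP}^{n}$ is normalized so that its class is the first Chern class of the hyperplane bundle (the positive generator of $H^2(\mathbb{CP}^n;\mathbb{Z})$), i.e. $\Omega=\frac{i}{2\pi}\partial\bar\partial\log\left(|Z_0|^2+\cdots+|Z_n|^2\right)$ in homogeneous coordinates. A symplectic form is a closed non-degenerate 2-form. *)

theory Defs
  imports
    "HOL-Analysis.Analysis"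
    "HOL-Library.Function_Algebras"
    "HOL-Algebra.Bij"
    "HOL-Algebra.Generated_Groups"
begin

section \<open>Smooth maps and differential forms on vector spaces\<close>

primrec Ck :: "nat \<Rightarrow> ('a::real_normed_vector \<Rightarrow> 'b::real_normed_vector) \<Rightarrow> bool" where
  "Ck 0 f \<longleftrightarrow> continuous_on UNIV f"
| "Ck (Suc n) f \<longleftrightarrow>
     (\<forall>x. f differentiable (at x)) \<and> (\<forall>v. Ck n (\<lambda>x. frechet_derivative f (at x) v))"

definition smooth :: "('a::real_normed_vector \<Rightarrow> 'b::real_normed_vector) \<Rightarrow> bool" where
  "smooth f \<longleftrightarrow> (\<forall>n. Ck n f)"

text \<open>A 1-form is a function of a base point and one tangent vector, a 2-form is a function of a
  base point and two tangent vectors.\<close>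

type_synonym 'a form1 = "'a \<Rightarrow> 'a \<Rightarrow> real"
type_synonym 'a form2 = "'a \<Rightarrow> 'a \<Rightarrow> 'a \<Rightarrow> real"

definition smooth_form1 :: "'a::real_normed_vector form1 \<Rightarrow> bool" where
  "smooth_form1 \<beta> \<longleftrightarrow> (\<forall>x. linear (\<beta> x)) \<and> (\<forall>u. smooth (\<lambda>x. \<beta> x u))"

definition smooth_form2 :: "'a::real_normed_vector form2 \<Rightarrow> bool" where
  "smooth_form2 \<alpha> \<longleftrightarrow>
     (\<forall>x u. linear (\<alpha> x u)) \<and> (\<forall>x u v. \<alpha> x u v = - \<alpha> x v u) \<and> (\<forall>u v. smooth (\<lambda>x. \<alpha> x u v))"

definition wedge :: "'a form1 \<Rightarrow> 'a form1 \<Rightarrow> 'a form2" where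
  "wedge \<alpha> \<beta> x u v = \<alpha> x u * \<beta> x v - \<alpha> x v * \<beta> x u"

text \<open>Exterior derivatives, evaluated on constant vector fields.\<close>

definition ext_d1 :: "'a::real_normed_vector form1 \<Rightarrow> 'a form2" where
  "ext_d1 \<beta> x u v =
     frechet_derivative (\<lambda>y. \<beta> y v) (at x) u - frechet_derivative (\<lambda>y. \<beta> y u) (at x) v"

definition ext_d2 :: "'a::real_normed_vector form2 \<Rightarrow> 'a \<Rightarrow> 'a \<Rightarrow> 'a \<Rightarrow> 'a \<Rightarrow> real" where
  "ext_d2 \<alpha> x u v w =
     frechet_derivative (\<lambda>y. \<alpha> y v w) (at x) u
   - frechet_derivative (\<lambda>y. \<alpha> y u w) (at x) v
   + frechet_derivative (\<lambda>y. \<alpha> y u v) (at x) w"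

definition pullback1 ::
  "('a::real_normed_vector \<Rightarrow> 'b::real_normed_vector) \<Rightarrow> 'b form1 \<Rightarrow> 'a form1" where
  "pullback1 f \<beta> x u = \<beta> (f x) (frechet_derivative f (at x) u)"

definition pullback2 ::
  "('a::real_normed_vector \<Rightarrow> 'b::real_normed_vector) \<Rightarrow> 'b form2 \<Rightarrow> 'a form2" where
  "pullback2 f \<alpha> x u v =
     \<alpha> (f x) (frechet_derivative f (at x) u) (frechet_derivative f (at x) v)"

section \<open>The Kodaira--Thurston manifold\<close>

text \<open>The coordinates \<open>(x, y, z, t)\<close> of a point \<open>p\<close> are \<open>(p$1, p$2, p$3, p$4)\<close>.\<close>

definition kt_a :: "real^4 \<Rightarrow> real^4" where
  "kt_a p = vector [p$1 + 1, p$2, p$3 + p$2, p$4]"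

definition kt_b :: "real^4 \<Rightarrow> real^4" where
  "kt_b p = vector [p$1, p$2 + 1, p$3, p$4]"

definition kt_c :: "real^4 \<Rightarrow> real^4" where
  "kt_c p = vector [p$1, p$2, p$3 + 1, p$4]"

definition kt_d :: "real^4 \<Rightarrow> real^4" where
  "kt_d p = vector [p$1, p$2, p$3, p$4 + 1]"

definition KT_group :: "(real^4 \<Rightarrow> real^4) set" where
  "KT_group = generate (BijGroup UNIV) {kt_a, kt_b, kt_c, kt_d}"

definition KT_proj :: "real^4 \<Rightarrow> (real^4) set" where
  "KT_proj p = {g p | g. g \<in> KT_group}"

definition KT_manifold :: "(real^4) set set" where
  "KT_manifold = range KT_proj"

text \<open>Since \<open>KT_group\<close> acts freely and properly discontinuously, \<open>KT_proj\<close> is a covering map, and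
  pulling back along it identifies the smooth forms on \<open>KT_manifold\<close> with the smooth
  \<open>KT_group\<close>-invariant forms on \<open>\<real>\<^sup>4\<close>; the tangent space at \<open>KT_proj p\<close> is identified with that
  at \<open>p\<close>. A form on the quotient is represented by this invariant form.\<close>

definition KT_form1 :: "(real^4) form1 \<Rightarrow> bool" where
  "KT_form1 \<beta> \<longleftrightarrow> smooth_form1 \<beta> \<and> (\<forall>g\<in>KT_group. pullback1 g \<beta> = \<beta>)"

definition KT_form2 :: "(real^4) form2 \<Rightarrow> bool" where
  "KT_form2 \<alpha> \<longleftrightarrow> smooth_form2 \<alpha> \<and> (\<forall>g\<in>KT_group. pullback2 g \<alpha> = \<alpha>)"

definition KT_closed_form2 :: "(real^4) form2 \<Rightarrow> bool" where
  "KT_closed_form2 \<alpha> \<longleftrightarrow> KT_form2 \<alpha> \<and> (\<forall>p u v w. ext_d2 \<alpha> p u v w = 0)"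

definition KT_symplectic :: "(real^4) form2 \<Rightarrow> bool" where
  "KT_symplectic \<alpha> \<longleftrightarrow> KT_closed_form2 \<alpha> \<and> (\<forall>p u. u \<noteq> 0 \<longrightarrow> (\<exists>v. \<alpha> p u v \<noteq> 0))"

text \<open>Equality of classes in the second de Rham cohomology of \<open>KT_manifold\<close>: the primitive is
  required to be a form on the quotient.\<close>

definition KT_cohomologous :: "(real^4) form2 \<Rightarrow> (real^4) form2 \<Rightarrow> bool" where
  "KT_cohomologous \<alpha> \<alpha>' \<longleftrightarrow> KT_closed_form2 \<alpha> \<and> KT_closed_form2 \<alpha>' \<and>
     (\<exists>\<beta>. KT_form1 \<beta> \<and> (\<forall>p u v. \<alpha> p u v - \<alpha>' p u v = ext_d1 \<beta> p u v))"

definition dcoord :: "4 \<Rightarrow> (real^4) form1" where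
  "dcoord i p u = u $ i"

text \<open>\<open>(dz - x dy) \<and> dx + dy \<and> dt\<close>\<close>

definition omega_KT :: "(real^4) form2" where
  "omega_KT p u v =
     wedge (\<lambda>q w. dcoord 3 q w - q$1 * dcoord 2 q w) (dcoord 1) p u v
   + wedge (dcoord 2) (dcoord 4) p u v"

section \<open>Projective space and the Fubini--Study form\<close>

definition cline :: "complex^'n \<Rightarrow> (complex^'n) set" where
  "cline Z = vec.span {Z}"

definition CP :: "(complex^'n) set set" where
  "CP = {cline Z | Z. Z \<noteq> 0}"

text \<open>The affine chart \<open>Z\<^sub>j \<noteq> 0\<close>, seen as a local section of the projection
  \<open>\<complex>\<^sup>n \<setminus> 0 \<rightarrow> CP\<close>: the representative with \<open>Z\<^sub>j = 1\<close>.\<close>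

definition cp_chart :: "'n \<Rightarrow> (complex^'n) set \<Rightarrow> complex^'n" where
  "cp_chart j L = (THE Z. Z \<in> L \<and> Z $ j = 1)"

definition wirtinger :: "'n::finite \<Rightarrow> (complex^'n \<Rightarrow> complex) \<Rightarrow> complex^'n \<Rightarrow> complex" where
  "wirtinger j f Z =
     (frechet_derivative f (at Z) (axis j 1) - \<i> * frechet_derivative f (at Z) (axis j \<i>)) / 2"

definition wirtinger_bar :: "'n::finite \<Rightarrow> (complex^'n \<Rightarrow> complex) \<Rightarrow> complex^'n \<Rightarrow> complex" where
  "wirtinger_bar j f Z =
     (frechet_derivative f (at Z) (axis j 1) + \<i> * frechet_derivative f (at Z) (axis j \<i>)) / 2"

text \<open>\<open>\<partial>\<partial>\<^sup>-f = \<Sum>\<^sub>i\<^sub>,\<^sub>j (\<partial>\<^sup>2f / \<partial>Z\<^sub>i \<partial>Z\<^sup>-\<^sub>j) dZ\<^sub>i \<and> dZ\<^sup>-\<^sub>j\<close>, where the superscript minus denotes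
  conjugation.\<close>

definition ddbar ::
  "(complex^'n \<Rightarrow> complex) \<Rightarrow> complex^'n \<Rightarrow> complex^'n \<Rightarrow> complex^'n::finite \<Rightarrow> complex" where
  "ddbar f Z u v =
     (\<Sum>i\<in>UNIV. \<Sum>j\<in>UNIV. wirtinger i (wirtinger_bar j f) Z * (u$i * cnj (v$j) - v$i * cnj (u$j)))"

text \<open>The Fubini--Study form in homogeneous coordinates. The form \<open>(\<i>/2\<pi>) \<partial>\<partial>\<^sup>-f\<close> is real for
  the real function \<open>f\<close> at hand, so that \<open>Re\<close> only changes the type.\<close>

definition fubini_study :: "(complex^'n::finite) form2" where
  "fubini_study Z u v =
     Re (\<i> / (2 * of_real pi) *
         ddbar (\<lambda>W. of_real (ln (\<Sum>j\<in>UNIV. (cmod (W$j))\<^sup>2))) Z u v)"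

text \<open>Pullback along a map \<open>\<phi> : KT_manifold \<rightarrow> CP\<close> of a form on \<open>CP\<close> given in homogeneous
  coordinates. Around \<open>p\<close> the map is written in an affine chart containing the image of \<open>p\<close>; the
  result does not depend on the chart, because a form given in homogeneous coordinates is the lift
  of a form on \<open>CP\<close>.\<close>

definition KT_pullback ::
  "((real^4) set \<Rightarrow> (complex^'n) set) \<Rightarrow> (complex^'n::finite) form2 \<Rightarrow> (real^4) form2" where
  "KT_pullback \<phi> \<Omega> p =
     (let j = (SOME j. \<exists>Z\<in>\<phi> (KT_proj p). Z $ j \<noteq> 0)
      in pullback2 (\<lambda>q. cp_chart j (\<phi> (KT_proj q))) \<Omega> p)"

section \<open>Theta functions\<close>

interpretation cfun: vector_space "\<lambda>(c::complex) (f::complex \<Rightarrow> complex) w. c * f w"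
  by unfold_locales (auto simp: fun_eq_iff algebra_simps)

definition theta_space :: "nat \<Rightarrow> complex \<Rightarrow> (complex \<Rightarrow> complex) set" where
  "theta_space k \<tau> = {f. f holomorphic_on UNIV \<and> (\<forall>w. f (w + 1) = f w) \<and>
     (\<forall>w. f (w + \<tau>) = exp (- 2 * of_real pi * \<i> * of_nat k * w) * f w)}"

text \<open>Holomorphy in two variables on an open set: existence of a complex linear derivative.\<close>

definition holomorphic2_on :: "(complex \<times> complex \<Rightarrow> complex) \<Rightarrow> (complex \<times> complex) set \<Rightarrow> bool" where
  "holomorphic2_on f S \<longleftrightarrow> (\<forall>x\<in>S. \<exists>a b. (f has_derivative (\<lambda>(u, v). a * u + b * v)) (at x))"

definition theta_family :: "nat \<Rightarrow> (nat \<Rightarrow> complex \<Rightarrow> complex \<Rightarrow> complex) \<Rightarrow> bool" where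
  "theta_family k \<theta> \<longleftrightarrow>
     (\<forall>p\<in>{1..k}. holomorphic2_on (\<lambda>(w, \<tau>). \<theta> p w \<tau>) (UNIV \<times> {\<tau>. Im \<tau> > 0})) \<and>
     (\<forall>\<tau>. Im \<tau> > 0 \<longrightarrow>
        inj_on (\<lambda>p w. \<theta> p w \<tau>) {1..k} \<and>
        cfun.independent ((\<lambda>p w. \<theta> p w \<tau>) ` {1..k}) \<and>
        cfun.span ((\<lambda>p w. \<theta> p w \<tau>) ` {1..k}) = theta_space k \<tau>) \<and>
     (\<forall>p\<in>{1..k}. \<forall>w \<tau>. Im \<tau> > 0 \<longrightarrow> \<theta> p w (\<tau> + 1) = \<theta> p w \<tau>)"

text \<open>The bijection \<open>e\<close> from the index type onto \<open>{1..k} \<times> {1..k}\<close> fixes the order of the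
  homogeneous coordinates.\<close>

definition theta_coords ::
  "(nat \<Rightarrow> complex \<Rightarrow> complex \<Rightarrow> complex) \<Rightarrow> ('n::finite \<Rightarrow> nat \<times> nat) \<Rightarrow> real^4 \<Rightarrow> complex^'n" where
  "theta_coords \<theta> e p =
     (\<chi> m. \<theta> (fst (e m)) (of_real (p$3) + \<i> * of_real (p$1)) (of_real (p$2) + \<i>)
         * \<theta> (snd (e m)) (of_real (p$2) + \<i> * of_real (p$4)) \<i>)"

text \<open>The value at an orbit is the line spanned by the homogeneous coordinates of any of its
  points.\<close>

definition theta_map ::
  "(nat \<Rightarrow> complex \<Rightarrow> complex \<Rightarrow> complex) \<Rightarrow> ('n::finite \<Rightarrow> nat \<times> nat)
     \<Rightarrow> (real^4) set \<Rightarrow> (complex^'n) set" where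
  "theta_map \<theta> e m = the_elem ((\<lambda>p. cline (theta_coords \<theta> e p)) ` m)"

text \<open>The group acts by bijections, and the map to projective space is well defined on orbits.\<close>

lemma kt_component [simp]:
  "kt_a p $ 1 = p$1 + 1" "kt_a p $ 2 = p$2" "kt_a p $ 3 = p$3 + p$2" "kt_a p $ 4 = p$4"
  "kt_b p $ 1 = p$1" "kt_b p $ 2 = p$2 + 1" "kt_b p $ 3 = p$3" "kt_b p $ 4 = p$4"
  "kt_c p $ 1 = p$1" "kt_c p $ 2 = p$2" "kt_c p $ 3 = p$3 + 1" "kt_c p $ 4 = p$4"
  "kt_d p $ 1 = p$1" "kt_d p $ 2 = p$2" "kt_d p $ 3 = p$3" "kt_d p $ 4 = p$4 + 1"
  by (simp_all add: kt_a_def kt_b_def kt_c_def kt_d_def vector_def)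

lemma kt_Bij: "{kt_a, kt_b, kt_c, kt_d} \<subseteq> carrier (BijGroup UNIV)"
proof -
  have "bij kt_a"
    by (rule bij_betw_byWitness[where f' = "\<lambda>p. vector [p$1 - 1, p$2, p$3 - p$2, p$4]"])
       (auto simp: vec_eq_iff forall_4 vector_def)
  moreover have "bij kt_b"
    by (rule bij_betw_byWitness[where f' = "\<lambda>p. vector [p$1, p$2 - 1, p$3, p$4]"])
       (auto simp: vec_eq_iff forall_4 vector_def)
  moreover have "bij kt_c"
    by (rule bij_betw_byWitness[where f' = "\<lambda>p. vector [p$1, p$2, p$3 - 1, p$4]"])
       (auto simp: vec_eq_iff forall_4 vector_def)
  moreover have "bij kt_d"
    by (rule bij_betw_byWitness[where f' = "\<lambda>p. vector [p$1, p$2, p$3, p$4 - 1]"])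
       (auto simp: vec_eq_iff forall_4 vector_def)
  ultimately show ?thesis
    by (simp add: BijGroup_def Bij_def)
qed

lemma BijGroup_UNIV_mult:
  "g \<in> carrier (BijGroup UNIV) \<Longrightarrow> h \<in> carrier (BijGroup UNIV) \<Longrightarrow>
     (g \<otimes>\<^bsub>BijGroup UNIV\<^esub> h) p = g (h p)"
  by (simp add: BijGroup_def compose_def)

lemma theta_coords_generator:
  assumes th: "theta_family k \<theta>" and e: "bij_betw e UNIV ({1..k} \<times> {1..k})"
    and g: "g \<in> {kt_a, kt_b, kt_c, kt_d}"
  shows "\<exists>c. c \<noteq> 0 \<and> theta_coords \<theta> e (g p) = c *s theta_coords \<theta> e p"
proof -
  have mem: "fst (e m) \<in> {1..k}" "snd (e m) \<in> {1..k}" for m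
    using bij_betwE[OF e, rule_format, of m] by (auto simp: mem_Times_iff)
  have sp: "(\<lambda>w. \<theta> q w \<tau>) \<in> theta_space k \<tau>" if "q \<in> {1..k}" "Im \<tau> > 0" for q \<tau>
  proof -
    have "(\<lambda>w. \<theta> q w \<tau>) \<in> (\<lambda>p w. \<theta> p w \<tau>) ` {1..k}"
      by (rule image_eqI[where x = q]) (use that in auto)
    then have "(\<lambda>w. \<theta> q w \<tau>) \<in> cfun.span ((\<lambda>p w. \<theta> p w \<tau>) ` {1..k})"
      by (rule cfun.span_base)
    then show ?thesis
      using th that unfolding theta_family_def by blast
  qed
  have one: "\<theta> q (w + 1) \<tau> = \<theta> q w \<tau>" if "q \<in> {1..k}" "Im \<tau> > 0" for q \<tau> w
    using sp[OF that] by (simp add: theta_space_def)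
  have quasi: "\<theta> q (w + \<tau>) \<tau> = exp (- 2 * of_real pi * \<i> * of_nat k * w) * \<theta> q w \<tau>"
    if "q \<in> {1..k}" "Im \<tau> > 0" for q \<tau> w
    using sp[OF that] by (simp add: theta_space_def)
  have per: "\<theta> q w (\<tau> + 1) = \<theta> q w \<tau>" if "q \<in> {1..k}" "Im \<tau> > 0" for q w \<tau>
    using th that by (auto simp: theta_family_def)
  define w where "w = of_real (p$3) + \<i> * of_real (p$1)"
  define \<tau> where "\<tau> = of_real (p$2) + \<i>"
  define w' where "w' = of_real (p$2) + \<i> * of_real (p$4)"
  have \<tau>: "Im \<tau> > 0" by (simp add: \<tau>_def)
  have i: "Im \<i> > 0" by simp
  have coords: "theta_coords \<theta> e q =
      (\<chi> m. \<theta> (fst (e m)) (of_real (q$3) + \<i> * of_real (q$1)) (of_real (q$2) + \<i>)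
           * \<theta> (snd (e m)) (of_real (q$2) + \<i> * of_real (q$4)) \<i>)" for q
    by (rule theta_coords_def)
  have a: "theta_coords \<theta> e (kt_a p) =
      exp (- 2 * of_real pi * \<i> * of_nat k * w) *s theta_coords \<theta> e p"
  proof -
    have "of_real (kt_a p $ 3) + \<i> * of_real (kt_a p $ 1) = w + \<tau>"
      by (simp add: w_def \<tau>_def algebra_simps)
    then show ?thesis
      unfolding vec_eq_iff coords vector_smult_component vec_lambda_beta
      by (simp only: kt_component w_def[symmetric] \<tau>_def[symmetric] w'_def[symmetric]
          quasi[OF mem(1) \<tau>] mult.assoc simp_thms)
  qed
  have b: "theta_coords \<theta> e (kt_b p) = 1 *s theta_coords \<theta> e p"
  proof -
    have "of_real (kt_b p $ 2) + \<i> = \<tau> + 1" "of_real (kt_b p $ 2) + \<i> * of_real (kt_b p $ 4) = w' + 1"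
      by (simp_all add: w'_def \<tau>_def)
    then show ?thesis
      unfolding vec_eq_iff coords vector_smult_component vec_lambda_beta
      by (simp only: kt_component w_def[symmetric] \<tau>_def[symmetric] w'_def[symmetric]
          per[OF mem(1) \<tau>] one[OF mem(2) i] mult_1_left simp_thms)
  qed
  have c: "theta_coords \<theta> e (kt_c p) = 1 *s theta_coords \<theta> e p"
  proof -
    have "of_real (kt_c p $ 3) + \<i> * of_real (kt_c p $ 1) = w + 1"
      by (simp add: w_def)
    then show ?thesis
      unfolding vec_eq_iff coords vector_smult_component vec_lambda_beta
      by (simp only: kt_component w_def[symmetric] \<tau>_def[symmetric] w'_def[symmetric]
          one[OF mem(1) \<tau>] mult_1_left simp_thms)
  qed
  have d: "theta_coords \<theta> e (kt_d p) =
      exp (- 2 * of_real pi * \<i> * of_nat k * w') *s theta_coords \<theta> e p"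
  proof -
    have "of_real (kt_d p $ 2) + \<i> * of_real (kt_d p $ 4) = w' + \<i>"
      by (simp add: w'_def algebra_simps)
    then show ?thesis
      unfolding vec_eq_iff coords vector_smult_component vec_lambda_beta
      by (simp only: kt_component w_def[symmetric] \<tau>_def[symmetric] w'_def[symmetric]
          quasi[OF mem(2) i] mult.left_commute mult.assoc simp_thms)
  qed
  from g consider "g = kt_a" | "g = kt_b" | "g = kt_c" | "g = kt_d" by blast
  then show ?thesis
  proof cases
    case 1
    show ?thesis unfolding 1 a by (rule exI, rule conjI[OF exp_not_eq_zero refl])
  next
    case 2
    show ?thesis unfolding 2 b by (rule exI, rule conjI[OF one_neq_zero refl])
  next
    case 3
    show ?thesis unfolding 3 c by (rule exI, rule conjI[OF one_neq_zero refl])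
  next
    case 4
    show ?thesis unfolding 4 d by (rule exI, rule conjI[OF exp_not_eq_zero refl])
  qed
qed

lemma theta_coords_group:
  assumes th: "theta_family k \<theta>" and e: "bij_betw e UNIV ({1..k} \<times> {1..k})"
    and g: "g \<in> KT_group"
  shows "\<exists>c. c \<noteq> 0 \<and> theta_coords \<theta> e (g p) = c *s theta_coords \<theta> e p"
proof -
  interpret G: group "BijGroup (UNIV :: (real^4) set)" by (rule group_BijGroup)
  have car: "h \<in> carrier (BijGroup UNIV)"
    if "h \<in> generate (BijGroup UNIV) {kt_a, kt_b, kt_c, kt_d}" for h
    using G.generate_in_carrier[OF kt_Bij that] .
  show ?thesis
    using g unfolding KT_group_def
  proof (induction arbitrary: p rule: generate.induct)
    case one
    show ?case by (rule exI[of _ 1]) (simp add: BijGroup_def)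
  next
    case (incl h)
    then show ?case by (rule theta_coords_generator[OF th e])
  next
    case (inv h)
    let ?h' = "inv\<^bsub>BijGroup UNIV\<^esub> h"
    have h: "h \<in> carrier (BijGroup UNIV)" using inv kt_Bij by blast
    have "h (?h' p) = (h \<otimes>\<^bsub>BijGroup UNIV\<^esub> ?h') p"
      using h by (intro BijGroup_UNIV_mult[symmetric] G.inv_closed)
    also have "\<dots> = p" using G.r_inv[OF h] by (simp add: BijGroup_def)
    finally have hp: "h (?h' p) = p" .
    obtain c where "c \<noteq> 0" "theta_coords \<theta> e (h (?h' p)) = c *s theta_coords \<theta> e (?h' p)"
      using theta_coords_generator[OF th e inv] by blast
    then show ?case
      unfolding hp by (intro exI[of _ "inverse c"]) (simp add: vector_smult_assoc)
  next
    case (eng h1 h2)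
    obtain c where c: "c \<noteq> 0" "theta_coords \<theta> e (h1 (h2 p)) = c *s theta_coords \<theta> e (h2 p)"
      using eng.IH(1) by blast
    obtain c' where c': "c' \<noteq> 0" "theta_coords \<theta> e (h2 p) = c' *s theta_coords \<theta> e p"
      using eng.IH(2) by blast
    show ?case
      using c c' BijGroup_UNIV_mult[OF car[OF eng.hyps(1)] car[OF eng.hyps(2)], of p]
      by (intro exI[of _ "c * c'"]) (simp add: vector_smult_assoc)
  qed
qed

lemma theta_map_KT_proj:
  assumes "theta_family k \<theta>" "bij_betw e UNIV ({1..k} \<times> {1..k})"
  shows "theta_map \<theta> e (KT_proj p) = cline (theta_coords \<theta> e p)"
proof -
  have "cline (theta_coords \<theta> e (g p)) = cline (theta_coords \<theta> e p)" if "g \<in> KT_group" for g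
  proof -
    obtain c where c: "c \<noteq> 0" "theta_coords \<theta> e (g p) = c *s theta_coords \<theta> e p"
      using theta_coords_group[OF assms \<open>g \<in> KT_group\<close>] by blast
    have "vec.span {c *s Z} = vec.span {Z}" for Z :: "complex^'n::finite"
      using c(1) vec.span_image_scale[of "{Z}" "\<lambda>_. c"] by simp
    then show ?thesis
      by (simp add: cline_def c(2))
  qed
  moreover have "KT_group \<noteq> {}"
    unfolding KT_group_def using generate.one by blast
  ultimately have "(\<lambda>q. cline (theta_coords \<theta> e q)) ` KT_proj p = {cline (theta_coords \<theta> e p)}"
    unfolding KT_proj_def by (auto simp: image_iff)
  then show ?thesis
    by (simp add: theta_map_def)
qed

end

theory Submission
  imports Defs "HOL-Complex_Analysis.Complex_Analysis"
begin

text \<open>On \<open>\<complex>\<^sup>n\<close> without the origin the Fubini--Study form is exact: with \<open>\<langle>a, b\<rangle> = \<Sum> a\<^sub>i cnj b\<^sub>i\<close> it is the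
differential of the form \<open>v \<mapsto> Im (\<langle>v, Z\<rangle> / \<langle>Z, Z\<rangle>) / 2\<pi>\<close>. For a nowhere vanishing map \<open>X\<close> from
\<open>\<real>\<^sup>4\<close> the pullback of this primitive is called \<open>log_norm_form\<close> below. The whole argument
takes place on \<open>\<real>\<^sup>4\<close> with these primitives.

The vector of homogeneous coordinates is a tensor product \<open>A \<otimes> B\<close>, where \<open>A\<close> collects the
functions \<open>\<theta>\<^sup>p(z + ix, y + i)\<close> and \<open>B\<close> the functions \<open>\<theta>\<^sup>q(y + it, i)\<close>. Because \<open>log |Z|\<^sup>2\<close> turns a
tensor product into a sum, the primitive for \<open>A \<otimes> B\<close> is the sum of those for \<open>A\<close> and \<open>B\<close>
(\<open>log_norm_form_segre\<close>), and the induced form splits accordingly.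

Closedness is immediate from exactness on \<open>\<real>\<^sup>4\<close>, and invariance holds because the form is
pulled back from the quotient.

Nondegeneracy: let \<open>w\<close> denote the first argument of a theta function. The \<open>A\<close>-part of the form,
restricted to the hyperplane \<open>dy = 0\<close>, is a positive multiple of \<open>dz \<and> dx\<close>, and the \<open>B\<close>-part is a
positive multiple of \<open>dy \<and> dt\<close>. The factors are the squared Fubini--Study lengths of \<open>\<partial>A/\<partial>w\<close> and \<open>\<partial>B/\<partial>w\<close>.
They are positive if theta functions of degree \<open>k\<close> have no common zero and their values and
derivatives at a point are linearly independent (\<open>theta_family_base_point_free\<close>,
\<open>theta_family_immersive\<close>). Both follow from theta functions with prescribed zeros: products of \<open>k\<close>
translates of the degree one function \<open>\<Prod>(1 - q\<^sup>n u) (1 - q\<^sup>n\<^sup>+\<^sup>1 / u)\<close> with \<open>u = exp (2\<pi>iw)\<close>, whose zeros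
are simple and may be chosen freely subject to one linear condition on their sum. For \<open>k \<ge> 3\<close> one
zero can be put at a given point and the others kept away from it.

The cohomology class: the factors of automorphy of \<open>A\<close> and \<open>B\<close> change the primitive by \<open>-k dz\<close>
under the generator \<open>a\<close> and by \<open>-k dy\<close> under \<open>d\<close>, and not at all under \<open>b\<close> and \<open>c\<close>. The form
\<open>k (x dz - x\<^sup>2/2 dy + t dy - dz/2)\<close> changes by exactly the opposite amounts and has differential
\<open>-k \<omega>\<close>. The sum of the two (\<open>theta_primitive\<close>) is therefore an invariant primitive of the
difference of the two symplectic forms.

Since the family of theta functions is only known to be holomorphic in two variables, smoothness
requires that partial derivatives of such functions are again holomorphic; this is obtained from
locally uniform convergence of difference quotients.\<close>

section \<open>Smooth maps and the exterior derivative\<close>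

lemma Ck_SucI:
  assumes "\<And>x. (f has_derivative f' x) (at x)" and "\<And>v. Ck n (\<lambda>x. f' x v)"
  shows "Ck (Suc n) f"
proof -
  have "frechet_derivative f (at x) = f' x" for x
    using frechet_derivative_at[OF assms(1)] by simp
  then show ?thesis
    using assms by (auto simp: differentiable_def)
qed

lemma Ck_has_derivative:
  "Ck (Suc n) f \<Longrightarrow> (f has_derivative frechet_derivative f (at x)) (at x)"
  by (simp add: frechet_derivative_works)

lemma Ck_SucD: "Ck (Suc n) f \<Longrightarrow> Ck n f"
proof (induction n arbitrary: f)
  case 0
  then show ?case
    by (auto intro!: continuous_at_imp_continuous_on differentiable_imp_continuous_within)
next
  case (Suc n)
  then show ?case by (metis Ck.simps(2))
qed

lemma Ck_const: "Ck n (\<lambda>x. c)"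
proof (induction n arbitrary: c)
  case (Suc n)
  show ?case by (rule Ck_SucI[OF has_derivative_const Suc])
qed simp

lemma Ck_bounded_linear:
  assumes "bounded_linear L" and "Ck n f"
  shows "Ck n (\<lambda>x. L (f x))"
  using assms(2)
proof (induction n arbitrary: f)
  case 0
  then show ?case
    using assms(1) by (auto intro: bounded_linear.continuous_on)
next
  case (Suc n)
  show ?case
    by (rule Ck_SucI[OF bounded_linear.has_derivative[OF assms(1) Ck_has_derivative[OF Suc.prems]]])
       (use Suc in simp)
qed

lemma Ck_linear_map:
  assumes "bounded_linear L"
  shows "Ck n L"
proof (cases n)
  case 0
  then show ?thesis using assms by (simp add: linear_continuous_on)
next
  case (Suc m)
  show ?thesis unfolding Suc
    by (rule Ck_SucI[OF bounded_linear.has_derivative[OF assms has_derivative_ident] Ck_const])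
qed

lemma Ck_add: "Ck n f \<Longrightarrow> Ck n g \<Longrightarrow> Ck n (\<lambda>x. f x + g x)"
proof (induction n arbitrary: f g)
  case 0
  then show ?case by (simp add: continuous_on_add)
next
  case (Suc n)
  show ?case
    by (rule Ck_SucI[OF has_derivative_add[OF Ck_has_derivative Ck_has_derivative, OF Suc.prems]])
       (use Suc in simp)
qed

lemma Ck_bilinear:
  assumes "bounded_bilinear B"
  shows "Ck n f \<Longrightarrow> Ck n g \<Longrightarrow> Ck n (\<lambda>x. B (f x) (g x))"
proof (induction n arbitrary: f g)
  case 0
  then show ?case using assms by (simp add: bounded_bilinear.continuous_on)
next
  case (Suc n)
  show ?case
  proof (rule Ck_SucI[OF bounded_bilinear.FDERIV[OF assms Ck_has_derivative Ck_has_derivative, OF Suc.prems]])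
    fix v
    show "Ck n (\<lambda>x. B (f x) (frechet_derivative g (at x) v) + B (frechet_derivative f (at x) v) (g x))"
      using Suc Ck_SucD[OF Suc.prems(1)] Ck_SucD[OF Suc.prems(2)]
      by (intro Ck_add Suc.IH) auto
  qed
qed

lemma Ck_inverse:
  fixes f :: "'a::real_normed_vector \<Rightarrow> 'b::real_normed_field"
  assumes "\<And>x. f x \<noteq> 0"
  shows "Ck n f \<Longrightarrow> Ck n (\<lambda>x. inverse (f x))"
proof (induction n)
  case 0
  then show ?case using assms by (simp add: continuous_on_inverse)
next
  case (Suc n)
  show ?case
  proof (rule Ck_SucI[OF Deriv.has_derivative_inverse[OF assms Ck_has_derivative[OF Suc.prems]]])
    fix v
    note m = Ck_bilinear[OF bounded_bilinear_mult]
    have "Ck n (\<lambda>x. -1 * (inverse (f x) * frechet_derivative f (at x) v * inverse (f x)))"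
      using Suc Ck_SucD[OF Suc.prems] by (intro m Ck_const) auto
    then show "Ck n (\<lambda>x. - (inverse (f x) * frechet_derivative f (at x) v * inverse (f x)))"
      by simp
  qed
qed

lemma smooth_has_derivative:
  "smooth f \<Longrightarrow> (f has_derivative frechet_derivative f (at x)) (at x)"
  unfolding smooth_def by (blast intro: Ck_has_derivative)

lemma smooth_directional:
  "smooth f \<Longrightarrow> smooth (\<lambda>x. frechet_derivative f (at x) v)"
  unfolding smooth_def by (metis Ck.simps(2))

lemma smooth_const [simp]: "smooth (\<lambda>x. c)"
  by (simp add: smooth_def Ck_const)

lemma smooth_bounded_linear: "bounded_linear L \<Longrightarrow> smooth f \<Longrightarrow> smooth (\<lambda>x. L (f x))"
  by (simp add: smooth_def Ck_bounded_linear)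

lemma smooth_linear_map: "bounded_linear L \<Longrightarrow> smooth L"
  by (simp add: smooth_def Ck_linear_map)

lemma smooth_component: "smooth (\<lambda>p::real^'n::finite. p $ i)"
  by (rule smooth_linear_map) (rule bounded_linear_vec_nth)

lemma smooth_add: "smooth f \<Longrightarrow> smooth g \<Longrightarrow> smooth (\<lambda>x. f x + g x)"
  by (simp add: smooth_def Ck_add)

lemma smooth_mult:
  fixes f g :: "'a::real_normed_vector \<Rightarrow> 'b::real_normed_algebra"
  shows "smooth f \<Longrightarrow> smooth g \<Longrightarrow> smooth (\<lambda>x. f x * g x)"
  by (simp add: smooth_def Ck_bilinear[OF bounded_bilinear_mult])

lemma smooth_minus: "smooth f \<Longrightarrow> smooth (\<lambda>x. - f x)"
  by (rule smooth_bounded_linear[OF bounded_linear_minus[OF bounded_linear_ident]])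

lemma smooth_diff: "smooth f \<Longrightarrow> smooth g \<Longrightarrow> smooth (\<lambda>x. f x - g x)"
  using smooth_add[of f "\<lambda>x. - g x"] smooth_minus[of g] by simp

lemma smooth_inverse:
  fixes f :: "'a::real_normed_vector \<Rightarrow> 'b::real_normed_field"
  shows "smooth f \<Longrightarrow> (\<And>x. f x \<noteq> 0) \<Longrightarrow> smooth (\<lambda>x. inverse (f x))"
  by (simp add: smooth_def Ck_inverse)

lemma smooth_sum: "(\<And>i. i \<in> I \<Longrightarrow> smooth (f i)) \<Longrightarrow> smooth (\<lambda>x. \<Sum>i\<in>I. f i x)"
  by (induction I rule: infinite_finite_induct) (auto intro: smooth_add)

lemma frechet_derivative_eqI: "(f has_derivative f') (at x) \<Longrightarrow> frechet_derivative f (at x) = f'"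
  by (metis frechet_derivative_at)

text \<open>Symmetry of second derivatives: the second difference over a parallelogram with sides
  \<open>s u\<close> and \<open>s v\<close> is symmetric in \<open>u\<close> and \<open>v\<close>, and two applications of the mean value theorem
  express it as \<open>s\<^sup>2\<close> times a mixed second derivative at a nearby point, in either order.\<close>

lemma second_difference_mvt:
  fixes f :: "'a::real_normed_vector \<Rightarrow> real"
  assumes f: "smooth f" and s: "s > 0"
  shows "\<exists>a b. 0 < a \<and> a < s \<and> 0 < b \<and> b < s \<and>
    f (x + s *\<^sub>R u + s *\<^sub>R v) - f (x + s *\<^sub>R u) - f (x + s *\<^sub>R v) + f x =
    s\<^sup>2 * frechet_derivative (\<lambda>y. frechet_derivative f (at y) u) (at (x + a *\<^sub>R u + b *\<^sub>R v)) v"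
proof -
  define D where "D = (\<lambda>y. frechet_derivative f (at y) u)"
  have D: "smooth D" unfolding D_def by (rule smooth_directional[OF f])
  have line: "((\<lambda>r. g (y + r *\<^sub>R w)) has_real_derivative frechet_derivative g (at (y + r *\<^sub>R w)) w) (at r)"
    if "smooth g" for g :: "'a \<Rightarrow> real" and y w r
  proof -
    have "((\<lambda>r. g (y + r *\<^sub>R w)) has_derivative
        (\<lambda>h. frechet_derivative g (at (y + r *\<^sub>R w)) (h *\<^sub>R w))) (at r)"
      by (rule has_derivative_compose[OF _ smooth_has_derivative[OF that]])
         (auto intro!: derivative_eq_intros)
    moreover have "linear (frechet_derivative g (at (y + r *\<^sub>R w)))"
      using smooth_has_derivative[OF that] has_derivative_linear by blast
    ultimately show ?thesis
      by (simp add: has_field_derivative_def linear_cmul mult.commute[of _ "frechet_derivative g _ w"])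
  qed
  define g where "g = (\<lambda>r. f ((x + s *\<^sub>R v) + r *\<^sub>R u) - f (x + r *\<^sub>R u))"
  have "\<exists>z. 0 < z \<and> z < s \<and> g s - g 0 = (s - 0) * (D ((x + s *\<^sub>R v) + z *\<^sub>R u) - D (x + z *\<^sub>R u))"
    unfolding g_def D_def by (rule MVT2[OF s]) (intro DERIV_diff line f)
  then obtain a where a: "0 < a" "a < s"
    "g s - g 0 = s * (D ((x + s *\<^sub>R v) + a *\<^sub>R u) - D (x + a *\<^sub>R u))" by auto
  have "\<exists>z. 0 < z \<and> z < s \<and> D ((x + a *\<^sub>R u) + s *\<^sub>R v) - D ((x + a *\<^sub>R u) + 0 *\<^sub>R v) =
      (s - 0) * frechet_derivative D (at ((x + a *\<^sub>R u) + z *\<^sub>R v)) v"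
    by (rule MVT2[OF s]) (intro line D)
  then obtain b where b: "0 < b" "b < s" "D ((x + a *\<^sub>R u) + s *\<^sub>R v) - D (x + a *\<^sub>R u) =
      s * frechet_derivative D (at ((x + a *\<^sub>R u) + b *\<^sub>R v)) v" by auto
  have "f (x + s *\<^sub>R u + s *\<^sub>R v) - f (x + s *\<^sub>R u) - f (x + s *\<^sub>R v) + f x = g s - g 0"
    by (simp add: g_def add_ac)
  also have "\<dots> = s\<^sup>2 * frechet_derivative D (at (x + a *\<^sub>R u + b *\<^sub>R v)) v"
    using a(3) b(3) by (simp add: add_ac power2_eq_square)
  finally show ?thesis using a b unfolding D_def by blast
qed

text \<open>The quotient on the left is symmetric in \<open>u\<close> and \<open>v\<close>, so this limit identifies the two mixed second
derivatives with each other.\<close>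

lemma mixed_derivative_limit:
  fixes f :: "'a::real_normed_vector \<Rightarrow> real"
  assumes f: "smooth f"
  shows "((\<lambda>s. (f (x + s *\<^sub>R u + s *\<^sub>R v) - f (x + s *\<^sub>R u) - f (x + s *\<^sub>R v) + f x) / s\<^sup>2) \<longlongrightarrow>
    frechet_derivative (\<lambda>y. frechet_derivative f (at y) u) (at x) v) (at_right 0)"
proof -
  define E where "E = (\<lambda>y. frechet_derivative (\<lambda>y. frechet_derivative f (at y) u) (at y) v)"
  define Q where "Q = (\<lambda>s. (f (x + s *\<^sub>R u + s *\<^sub>R v) - f (x + s *\<^sub>R u) - f (x + s *\<^sub>R v) + f x) / s\<^sup>2)"
  have "\<exists>a b. 0 < a \<and> a < s \<and> 0 < b \<and> b < s \<and> Q s = E (x + a *\<^sub>R u + b *\<^sub>R v)" if "s > 0" for s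
    using second_difference_mvt[OF f that, of x u v] that unfolding Q_def E_def
    by (metis nonzero_mult_div_cancel_left power_not_zero less_irrefl)
  then obtain a b where ab: "\<And>s. s > 0 \<Longrightarrow> 0 < a s \<and> a s < s \<and> 0 < b s \<and> b s < s \<and>
      Q s = E (x + a s *\<^sub>R u + b s *\<^sub>R v)" by metis
  have pos: "\<forall>\<^sub>F s::real in at_right 0. s > 0" by (rule eventually_at_right_less)
  have id: "((\<lambda>s::real. s) \<longlongrightarrow> 0) (at_right 0)" by (intro tendsto_intros)
  have "(a \<longlongrightarrow> 0) (at_right 0)" "(b \<longlongrightarrow> 0) (at_right 0)"
    by (rule tendsto_sandwich[OF _ _ tendsto_const id];
        rule eventually_mono[OF pos]; use ab in fastforce)+
  then have "((\<lambda>s. x + a s *\<^sub>R u + b s *\<^sub>R v) \<longlongrightarrow> x + 0 *\<^sub>R u + 0 *\<^sub>R v) (at_right 0)"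
    by (intro tendsto_intros)
  moreover have "Ck 0 E"
    using smooth_directional[OF smooth_directional[OF f]] unfolding E_def smooth_def by blast
  then have "isCont E x" by (simp add: continuous_on_eq_continuous_at)
  ultimately have "((\<lambda>s. E (x + a s *\<^sub>R u + b s *\<^sub>R v)) \<longlongrightarrow> E x) (at_right 0)"
    using isCont_tendsto_compose by fastforce
  then have "(Q \<longlongrightarrow> E x) (at_right 0)"
    by (rule Lim_transform_eventually) (rule eventually_mono[OF pos], use ab in auto)
  then show ?thesis unfolding E_def Q_def .
qed

text \<open>The inner product with a fixed vector reduces this to real-valued maps, for which the mean value
theorem is available.\<close>

lemma smooth_second_derivative_symmetric:
  fixes f :: "'a::real_normed_vector \<Rightarrow> 'b::real_inner"
  assumes f: "smooth f"
  shows "frechet_derivative (\<lambda>y. frechet_derivative f (at y) u) (at x) v =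
         frechet_derivative (\<lambda>y. frechet_derivative f (at y) v) (at x) u"
proof -
  have inner_out: "frechet_derivative (\<lambda>y. inner (g y) b) (at y) w = inner (frechet_derivative g (at y) w) b"
    if "smooth g" for g :: "'a \<Rightarrow> 'b" and b y w
    using frechet_derivative_eqI[OF has_derivative_inner_left[OF smooth_has_derivative[OF that], of b]]
    by simp
  have "inner (frechet_derivative (\<lambda>y. frechet_derivative f (at y) u) (at x) v) b =
        inner (frechet_derivative (\<lambda>y. frechet_derivative f (at y) v) (at x) u) b" for b
  proof -
    define g where "g = (\<lambda>y. inner (f y) b)"
    have g: "smooth g" unfolding g_def
      by (rule smooth_bounded_linear[OF bounded_linear_inner_left f])
    have "(\<lambda>s. (g (x + s *\<^sub>R u + s *\<^sub>R v) - g (x + s *\<^sub>R u) - g (x + s *\<^sub>R v) + g x) / s\<^sup>2) =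
          (\<lambda>s. (g (x + s *\<^sub>R v + s *\<^sub>R u) - g (x + s *\<^sub>R v) - g (x + s *\<^sub>R u) + g x) / s\<^sup>2)"
      by (simp add: add_ac fun_eq_iff algebra_simps)
    then have "frechet_derivative (\<lambda>y. frechet_derivative g (at y) u) (at x) v =
               frechet_derivative (\<lambda>y. frechet_derivative g (at y) v) (at x) u"
      using mixed_derivative_limit[OF g, of x u v] mixed_derivative_limit[OF g, of x v u]
      by (intro tendsto_unique[OF trivial_limit_at_right_real]) auto
    then show ?thesis
      unfolding g_def inner_out[OF f] inner_out[OF smooth_directional[OF f]] .
  qed
  then show ?thesis by (metis inner_commute vector_eq_ldot)
qed

lemma smooth_form1_smooth: "smooth_form1 \<beta> \<Longrightarrow> smooth (\<lambda>y. \<beta> y v)"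
  and smooth_form1_linear: "smooth_form1 \<beta> \<Longrightarrow> linear (\<beta> y)"
  by (auto simp: smooth_form1_def)

lemma ext_d1_add:
  assumes "smooth_form1 \<beta>" "smooth_form1 \<gamma>"
  shows "ext_d1 (\<lambda>p v. \<beta> p v + \<gamma> p v) p u v = ext_d1 \<beta> p u v + ext_d1 \<gamma> p u v"
  using frechet_derivative_eqI[OF has_derivative_add[OF smooth_has_derivative smooth_has_derivative,
      OF smooth_form1_smooth smooth_form1_smooth, OF assms]]
  by (simp add: ext_d1_def)

lemma smooth_form1_add:
  "smooth_form1 \<beta> \<Longrightarrow> smooth_form1 \<gamma> \<Longrightarrow> smooth_form1 (\<lambda>p v. \<beta> p v + \<gamma> p v)"
  by (auto simp: smooth_form1_def linear_compose_add intro: smooth_add)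

lemma smooth_form2_ext_d1:
  assumes "smooth_form1 \<beta>"
  shows "smooth_form2 (ext_d1 \<beta>)"
proof -
  note s = smooth_form1_smooth[OF assms]
  note h = smooth_has_derivative[OF s]
  have lin: "linear (frechet_derivative (\<lambda>y. \<beta> y u) (at x))" for u x
    using h has_derivative_linear by blast
  have "linear (ext_d1 \<beta> x u)" for x u
  proof (rule linearI)
    fix v w and r :: real
    have "(\<lambda>y. \<beta> y (v + w)) = (\<lambda>y. \<beta> y v + \<beta> y w)"
      by (simp add: linear_add[OF smooth_form1_linear[OF assms]])
    then show "ext_d1 \<beta> x u (v + w) = ext_d1 \<beta> x u v + ext_d1 \<beta> x u w"
      using frechet_derivative_eqI[OF has_derivative_add[OF h h]]
      by (simp add: ext_d1_def linear_add[OF lin])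
    have "(\<lambda>y. \<beta> y (r *\<^sub>R v)) = (\<lambda>y. r *\<^sub>R \<beta> y v)"
      by (simp add: linear_cmul[OF smooth_form1_linear[OF assms]])
    then show "ext_d1 \<beta> x u (r *\<^sub>R v) = r *\<^sub>R ext_d1 \<beta> x u v"
      using frechet_derivative_eqI[OF has_derivative_scaleR_right[OF h]]
      by (simp add: ext_d1_def linear_cmul[OF lin] algebra_simps)
  qed
  moreover have "smooth (\<lambda>x. ext_d1 \<beta> x u v)" for u v
    unfolding ext_d1_def by (intro smooth_diff smooth_directional s)
  ultimately show ?thesis
    by (auto simp: smooth_form2_def) (simp add: ext_d1_def)
qed

text \<open>The six second derivatives cancel in pairs by their symmetry.\<close>

lemma ext_d2_ext_d1:
  assumes "smooth_form1 \<beta>"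
  shows "ext_d2 (ext_d1 \<beta>) p u v w = 0"
proof -
  note s = smooth_form1_smooth[OF assms]
  note h = smooth_has_derivative[OF smooth_directional[OF s]]
  have "frechet_derivative (\<lambda>y. ext_d1 \<beta> y a b) (at p) c =
      frechet_derivative (\<lambda>y. frechet_derivative (\<lambda>y. \<beta> y b) (at y) a) (at p) c -
      frechet_derivative (\<lambda>y. frechet_derivative (\<lambda>y. \<beta> y a) (at y) b) (at p) c" for a b c
    using frechet_derivative_eqI[OF has_derivative_diff[OF h h]] by (simp add: ext_d1_def)
  then show ?thesis
    by (simp add: ext_d2_def smooth_second_derivative_symmetric[OF s, of _ u p v]
        smooth_second_derivative_symmetric[OF s, of _ u p w]
        smooth_second_derivative_symmetric[OF s, of _ v p w])
qed

section \<open>Holomorphic functions of two variables\<close>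

text \<open>Continuity and holomorphy in each variable is easier to pass to partial derivatives than joint
complex differentiability, to which it is equivalent on products of open sets.\<close>

definition holomorphic_separately ::
  "(complex \<Rightarrow> complex \<Rightarrow> complex) \<Rightarrow> complex set \<Rightarrow> complex set \<Rightarrow> bool" where
  "holomorphic_separately f S T \<longleftrightarrow> continuous_on (S \<times> T) (\<lambda>(w, \<tau>). f w \<tau>) \<and>
     (\<forall>\<tau>\<in>T. (\<lambda>w. f w \<tau>) holomorphic_on S) \<and> (\<forall>w\<in>S. f w holomorphic_on T)"

lemma holomorphic_separately_swap:
  assumes "holomorphic_separately f S T"
  shows "holomorphic_separately (\<lambda>\<tau> w. f w \<tau>) T S"
proof -
  have "continuous_on (T \<times> S) ((\<lambda>(w, \<tau>). f w \<tau>) \<circ> prod.swap)"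
    using assms by (intro continuous_on_compose continuous_on_swap)
      (auto simp: holomorphic_separately_def product_swap)
  then show ?thesis
    using assms by (simp add: holomorphic_separately_def o_def case_prod_unfold)
qed

text \<open>The remainder in Taylor's formula of order one is bounded by a multiple of \<open>|h|\<^sup>2\<close>, where the constant
comes from Cauchy's bound for the second derivative and the maximum of \<open>|f|\<close> on a compact
neighbourhood. It is therefore uniform in both variables.\<close>

lemma difference_quotient_uniform_limit:
  assumes f: "holomorphic_separately f S T" and S: "open S" and T: "open T"
    and w0: "w0 \<in> S" and t0: "t0 \<in> T"
  obtains r where "r > 0" "cball w0 (2 * r) \<subseteq> S" "cball t0 r \<subseteq> T"
    "uniform_limit (cball w0 r \<times> cball t0 r)
       (\<lambda>n (w, \<tau>). (f (w + of_real (r / real (Suc n))) \<tau> - f w \<tau>) / of_real (r / real (Suc n)))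
       (\<lambda>(w, \<tau>). deriv (\<lambda>w. f w \<tau>) w) sequentially"
proof -
  obtain r1 where r1: "r1 > 0" "cball w0 r1 \<subseteq> S" using open_contains_cball S w0 by blast
  obtain r2 where r2: "r2 > 0" "cball t0 r2 \<subseteq> T" using open_contains_cball T t0 by blast
  \<comment> \<open>A disc of radius \<open>3r\<close> leaves room for centres at distance \<open>2r\<close> and Cauchy discs of radius \<open>r\<close>.\<close>
  define r where "r = min (r1 / 3) r2"
  have r: "r > 0" "cball w0 (3 * r) \<subseteq> S" "cball t0 r \<subseteq> T"
    using r1 r2 by (auto simp: r_def subset_eq)
  have S2: "cball w0 (2 * r) \<subseteq> S" using r by (auto simp: subset_eq)
  have cont: "continuous_on (S \<times> T) (\<lambda>(w, \<tau>). f w \<tau>)"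
    using f by (simp add: holomorphic_separately_def)
  have "compact ((\<lambda>(w, \<tau>). f w \<tau>) ` (cball w0 (3 * r) \<times> cball t0 r))"
    by (intro compact_continuous_image continuous_on_subset[OF cont] compact_Times compact_cball)
       (use r in auto)
  then obtain M where M: "M > 0" "\<And>x. x \<in> (\<lambda>(w, \<tau>). f w \<tau>) ` (cball w0 (3 * r) \<times> cball t0 r) \<Longrightarrow> norm x \<le> M"
    using compact_imp_bounded bounded_pos by metis
  have bound: "norm (f w \<tau>) < M + 1" if "dist w0 w \<le> 3 * r" "dist t0 \<tau> \<le> r" for w \<tau>
    using M(2)[of "f w \<tau>"] that by force
  define B where "B = 2 * (M + 1) / r\<^sup>2"
  have est: "norm ((f (w + h) \<tau> - f w \<tau>) / h - deriv (\<lambda>w. f w \<tau>) w) \<le> B * norm h"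
    if w: "w \<in> cball w0 r" and t: "\<tau> \<in> cball t0 r" and h: "norm h \<le> r" "h \<noteq> 0" for w \<tau> h
  proof -
    define F where "F = (\<lambda>i. (deriv ^^ i) (\<lambda>w. f w \<tau>))"
    have hol: "(\<lambda>w. f w \<tau>) holomorphic_on S"
      using f t r(3) by (auto simp: holomorphic_separately_def)
    have "cmod (F 0 (w + h) - (\<Sum>i\<le>1. F i w * ((w + h) - w) ^ i / fact i))
        \<le> B * cmod ((w + h) - w) ^ Suc 1 / fact 1"
    proof (rule complex_Taylor[of "cball w0 (2 * r)"])
      show "(F i has_field_derivative F (Suc i) x) (at x within cball w0 (2 * r))"
        if "x \<in> cball w0 (2 * r)" for i x
      proof -
        have "F i holomorphic_on S" unfolding F_def by (rule holomorphic_higher_deriv[OF hol S])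
        then have "(F i has_field_derivative deriv (F i) x) (at x)"
          using S that S2 holomorphic_derivI by blast
        then show ?thesis by (simp add: F_def has_field_derivative_at_within)
      qed
      show "cmod (F (Suc 1) x) \<le> B" if x: "x \<in> cball w0 (2 * r)" for x
      proof -
        have sub: "cball x r \<subseteq> cball w0 (3 * r)"
        proof
          fix y assume "y \<in> cball x r"
          then show "y \<in> cball w0 (3 * r)"
            using x dist_triangle[of w0 y x] by simp
        qed
        have "cmod ((deriv ^^ 2) (\<lambda>w. f w \<tau>) x) \<le> fact 2 * (M + 1) / r ^ 2"
        proof (rule Cauchy_higher_deriv_bound[where y = 0])
          show "(\<lambda>w. f w \<tau>) holomorphic_on ball x r"
            using hol sub r ball_subset_cball by (meson holomorphic_on_subset subset_trans)
          show "continuous_on (cball x r) (\<lambda>w. f w \<tau>)"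
            using hol sub r by (meson holomorphic_on_imp_continuous_on holomorphic_on_subset subset_trans)
          show "f y \<tau> \<in> ball 0 (M + 1)" if "y \<in> ball x r" for y
            using bound[of y \<tau>] that sub t ball_subset_cball[of x r] by (auto simp: subset_eq)
        qed (use r in auto)
        then show ?thesis by (simp add: F_def B_def numeral_2_eq_2)
      qed
      show "w \<in> cball w0 (2 * r)" "w + h \<in> cball w0 (2 * r)"
        using w h r norm_triangle_ineq[of "w - w0" h]
        by (auto simp: dist_norm norm_minus_commute algebra_simps)
    qed auto
    then have "cmod (f (w + h) \<tau> - f w \<tau> - deriv (\<lambda>w. f w \<tau>) w * h) \<le> B * (norm h)\<^sup>2"
      by (simp add: F_def power2_eq_square algebra_simps)
    moreover have "(f (w + h) \<tau> - f w \<tau>) / h - deriv (\<lambda>w. f w \<tau>) w =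
        (f (w + h) \<tau> - f w \<tau> - deriv (\<lambda>w. f w \<tau>) w * h) / h"
      using h by (simp add: field_simps)
    ultimately show ?thesis
      using h by (simp add: norm_divide divide_le_eq power2_eq_square mult.assoc)
  qed
  have lim: "(\<lambda>n. B * (r / real (Suc n))) \<longlonglongrightarrow> 0"
    using tendsto_mult_right_zero[OF tendsto_mult_right_zero[OF LIMSEQ_inverse_real_of_nat, of r], of B]
    by (simp add: field_simps)
  have "uniform_limit (cball w0 r \<times> cball t0 r)
       (\<lambda>n (w, \<tau>). (f (w + of_real (r / real (Suc n))) \<tau> - f w \<tau>) / of_real (r / real (Suc n)))
       (\<lambda>(w, \<tau>). deriv (\<lambda>w. f w \<tau>) w) sequentially"
  proof (rule uniform_limitI)
    fix \<epsilon> :: real assume "\<epsilon> > 0"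
    then have "\<forall>\<^sub>F n in sequentially. B * (r / real (Suc n)) < \<epsilon>"
      using lim order_tendstoD(2) by blast
    then show "\<forall>\<^sub>F n in sequentially. \<forall>x\<in>cball w0 r \<times> cball t0 r.
        dist (case x of (w, \<tau>) \<Rightarrow> (f (w + of_real (r / real (Suc n))) \<tau> - f w \<tau>) / of_real (r / real (Suc n)))
          (case x of (w, \<tau>) \<Rightarrow> deriv (\<lambda>w. f w \<tau>) w) < \<epsilon>"
    proof eventually_elim
      case (elim n)
      show ?case
      proof (clarify, goal_cases)
        case (1 w \<tau>)
        have "norm (of_real (r / real (Suc n)) :: complex) = r / real (Suc n)"
          using r by (simp add: norm_divide del: of_nat_Suc)
        moreover have "r / real (Suc n) \<le> r" using r by (simp add: divide_le_eq)
        ultimately show ?case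
          using est[OF 1, of "of_real (r / real (Suc n))"] elim r by (simp add: dist_norm del: of_nat_Suc)
      qed
    qed
  qed
  then show ?thesis using that r S2 by blast
qed

text \<open>Continuity and holomorphy in the second variable are inherited from the difference quotients in the
first variable, which converge locally uniformly.\<close>

lemma holomorphic_separately_deriv:
  assumes f: "holomorphic_separately f S T" and S: "open S" and T: "open T"
  shows "holomorphic_separately (\<lambda>w \<tau>. deriv (\<lambda>w. f w \<tau>) w) S T"
proof -
  have cont: "continuous_on (S \<times> T) (\<lambda>(w, \<tau>). f w \<tau>)"
    using f by (simp add: holomorphic_separately_def)
  have "isCont (\<lambda>(w, \<tau>). deriv (\<lambda>w. f w \<tau>) w) (w0, t0) \<and>
        (\<lambda>\<tau>. deriv (\<lambda>w. f w \<tau>) w0) field_differentiable (at t0)" if w0: "w0 \<in> S" and t0: "t0 \<in> T" for w0 t0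
  proof -
    obtain r where r: "r > 0" "cball w0 (2 * r) \<subseteq> S" "cball t0 r \<subseteq> T" and
      lim: "uniform_limit (cball w0 r \<times> cball t0 r)
         (\<lambda>n (w, \<tau>). (f (w + of_real (r / real (Suc n))) \<tau> - f w \<tau>) / of_real (r / real (Suc n)))
         (\<lambda>(w, \<tau>). deriv (\<lambda>w. f w \<tau>) w) sequentially"
      using difference_quotient_uniform_limit[OF f S T w0 t0] .
    define h :: "nat \<Rightarrow> complex" where "h = (\<lambda>n. of_real (r / real (Suc n)))"
    have h: "norm (h n) \<le> r" "h n \<noteq> 0" for n
      using r by (simp_all add: h_def divide_le_eq norm_divide del: of_nat_Suc)
    have shift: "w + h n \<in> S" "w \<in> S" if "w \<in> cball w0 r" for w n
      using r(1,2) that h(1)[of n] norm_triangle_ineq[of "w - w0" "h n"]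
      by (auto simp: subset_eq dist_norm norm_minus_commute algebra_simps)
    have contq: "continuous_on (cball w0 r \<times> cball t0 r) (\<lambda>(w, \<tau>). (f (w + h n) \<tau> - f w \<tau>) / h n)" for n
    proof -
      have "continuous_on (cball w0 r \<times> cball t0 r) (\<lambda>x. (\<lambda>(w, \<tau>). f w \<tau>) (fst x + h n, snd x))"
        by (rule continuous_on_compose2[OF cont]) (use shift r in \<open>auto intro!: continuous_intros\<close>)
      moreover have "continuous_on (cball w0 r \<times> cball t0 r) (\<lambda>x. (\<lambda>(w, \<tau>). f w \<tau>) x)"
        by (rule continuous_on_subset[OF cont]) (use shift r in auto)
      ultimately show ?thesis
        using h(2)[of n] unfolding case_prod_unfold by (auto intro!: continuous_intros)
    qed
    have "continuous_on (cball w0 r \<times> cball t0 r) (\<lambda>(w, \<tau>). deriv (\<lambda>w. f w \<tau>) w)"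
      by (rule uniform_limit_theorem[OF _ lim]) (use contq in \<open>auto simp: h_def\<close>)
    moreover have "(w0, t0) \<in> interior (cball w0 r \<times> cball t0 r)"
      using r by (simp add: interior_Times)
    ultimately have 1: "isCont (\<lambda>(w, \<tau>). deriv (\<lambda>w. f w \<tau>) w) (w0, t0)"
      using continuous_on_interior by blast
    have sec: "f w holomorphic_on T" if "w \<in> S" for w
      using f that by (simp add: holomorphic_separately_def)
    have hol: "(\<lambda>\<tau>. (f (w0 + h n) \<tau> - f w0 \<tau>) / h n) holomorphic_on cball t0 r" for n
      using sec[OF shift(1)[of w0 n]] sec[OF \<open>w0 \<in> S\<close>] r h(2)[of n]
      by (auto intro!: holomorphic_intros intro: holomorphic_on_subset)
    have "uniform_limit (cball t0 r) (\<lambda>n \<tau>. (f (w0 + h n) \<tau> - f w0 \<tau>) / h n)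
        (\<lambda>\<tau>. deriv (\<lambda>w. f w \<tau>) w0) sequentially"
      unfolding uniform_limit_iff
    proof (intro allI impI)
      fix \<epsilon> :: real assume "\<epsilon> > 0"
      from uniform_limitD[OF lim this]
      show "\<forall>\<^sub>F n in sequentially. \<forall>\<tau>\<in>cball t0 r.
          dist ((f (w0 + h n) \<tau> - f w0 \<tau>) / h n) (deriv (\<lambda>w. f w \<tau>) w0) < \<epsilon>"
        by eventually_elim (use r in \<open>auto simp: h_def\<close>)
    qed
    then have "(\<lambda>\<tau>. deriv (\<lambda>w. f w \<tau>) w0) holomorphic_on ball t0 r"
    proof (rule holomorphic_uniform_limit[rotated])
      show "\<forall>\<^sub>F n in sequentially. continuous_on (cball t0 r) (\<lambda>\<tau>. (f (w0 + h n) \<tau> - f w0 \<tau>) / h n) \<and>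
          (\<lambda>\<tau>. (f (w0 + h n) \<tau> - f w0 \<tau>) / h n) holomorphic_on ball t0 r"
        using hol by (auto intro!: always_eventually holomorphic_on_imp_continuous_on
            intro: holomorphic_on_subset[OF _ ball_subset_cball])
    qed auto
    then show ?thesis
      using 1 r holomorphic_on_imp_differentiable_at[of _ "ball t0 r" t0] by auto
  qed
  note * = this
  have "continuous_on (S \<times> T) (\<lambda>(w, \<tau>). deriv (\<lambda>w. f w \<tau>) w)"
    by (rule continuous_at_imp_continuous_on) (use * in auto)
  moreover have "(\<lambda>\<tau>. deriv (\<lambda>w. f w \<tau>) w) holomorphic_on T" if "w \<in> S" for w
    unfolding holomorphic_on_def using * that field_differentiable_at_within by blast
  moreover have "(\<lambda>w. deriv (\<lambda>w. f w \<tau>) w) holomorphic_on S" if "\<tau> \<in> T" for \<tau>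
    using f that S by (auto simp: holomorphic_separately_def intro!: holomorphic_deriv)
  ultimately show ?thesis by (simp add: holomorphic_separately_def)
qed

lemma holomorphic_separately_deriv2:
  assumes "holomorphic_separately f S T" "open S" "open T"
  shows "holomorphic_separately (\<lambda>w \<tau>. deriv (f w) \<tau>) S T"
  using holomorphic_separately_swap[OF holomorphic_separately_deriv[OF
      holomorphic_separately_swap[OF assms(1)] assms(3,2)]] by simp

lemma holomorphic_separately_has_derivative:
  assumes f: "holomorphic_separately f S T" and S: "open S" and T: "open T"
    and w: "w \<in> S" and t: "\<tau> \<in> T"
  shows "((\<lambda>(w, \<tau>). f w \<tau>) has_derivative
     (\<lambda>(a, b). deriv (\<lambda>w. f w \<tau>) w * a + deriv (f w) \<tau> * b)) (at (w, \<tau>))"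
proof -
  obtain r where r: "r > 0" "ball \<tau> r \<subseteq> T" using T t open_contains_ball by blast
  have "((\<lambda>(w, \<tau>). f w \<tau>) has_derivative
     (\<lambda>(a, b). deriv (\<lambda>w. f w \<tau>) w * a + blinfun_apply (blinfun_mult_right (deriv (f w) \<tau>)) b))
     (at (w, \<tau>) within S \<times> ball \<tau> r)"
  proof (rule has_derivative_partialsI)
    have "((\<lambda>w. f w \<tau>) has_field_derivative deriv (\<lambda>w. f w \<tau>) w) (at w)"
      using f w t S holomorphic_derivI unfolding holomorphic_separately_def by blast
    then show "((\<lambda>w. f w \<tau>) has_derivative (*) (deriv (\<lambda>w. f w \<tau>) w)) (at w within S)"
      using has_derivative_at_withinI unfolding has_field_derivative_def by blast
    show "((\<lambda>y. f x y) has_derivative blinfun_apply (blinfun_mult_right (deriv (f x) y))) (at y within ball \<tau> r)"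
      if "x \<in> S" "y \<in> ball \<tau> r" for x y
    proof -
      have "(f x has_field_derivative deriv (f x) y) (at y)"
        using f that r T holomorphic_derivI unfolding holomorphic_separately_def by blast
      then show ?thesis
        using has_derivative_at_withinI unfolding has_field_derivative_def by auto
    qed
    have c: "continuous_on (S \<times> T) (\<lambda>(x, y). deriv (f x) y)"
      using holomorphic_separately_deriv2[OF f S T] by (simp add: holomorphic_separately_def)
    have "continuous_on (S \<times> ball \<tau> r) (\<lambda>x. blinfun_mult_right ((\<lambda>(x, y). deriv (f x) y) x))"
      by (rule bounded_linear.continuous_on[OF bounded_linear_blinfun_mult_right])
         (rule continuous_on_subset[OF c], use r in auto)
    then show "continuous (at (w, \<tau>) within S \<times> ball \<tau> r) (\<lambda>(x, y). blinfun_mult_right (deriv (f x) y))"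
      using w r by (simp add: continuous_on_eq_continuous_within case_prod_unfold)
  qed (use r in auto)
  moreover have "at (w, \<tau>) within S \<times> ball \<tau> r = at (w, \<tau>)"
    by (rule at_within_open) (use w r S in \<open>auto intro: open_Times\<close>)
  ultimately show ?thesis by simp
qed

lemma holomorphic2_imp_separately:
  assumes "holomorphic2_on (\<lambda>(w, \<tau>). f w \<tau>) (S \<times> T)"
  shows "holomorphic_separately f S T"
proof -
  have cont: "continuous_on (S \<times> T) (\<lambda>(w, \<tau>). f w \<tau>)"
  proof (intro continuous_at_imp_continuous_on ballI)
    fix x assume x: "x \<in> S \<times> T"
    show "isCont (\<lambda>(w, \<tau>). f w \<tau>) x"
      using assms[unfolded holomorphic2_on_def, rule_format, OF x]
      by (elim exE) (rule has_derivative_continuous)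
  qed
  have "(\<lambda>w. f w \<tau>) field_differentiable (at w) \<and> f w field_differentiable (at \<tau>)"
    if w: "w \<in> S" and t: "\<tau> \<in> T" for w \<tau>
  proof -
    obtain a b where d: "((\<lambda>(w, \<tau>). f w \<tau>) has_derivative (\<lambda>(u, v). a * u + b * v)) (at (w, \<tau>))"
      using assms[unfolded holomorphic2_on_def, rule_format, OF SigmaI, OF w t] by (elim exE)
    have L: "((\<lambda>x. (x, \<tau>)) has_derivative (\<lambda>u. (u, 0))) (at w)"
      and R: "((\<lambda>x. (w, x)) has_derivative (\<lambda>v. (0, v))) (at \<tau>)"
      by (auto intro!: derivative_eq_intros)
    show ?thesis
      using has_derivative_compose[OF L d] has_derivative_compose[OF R d]
      unfolding field_differentiable_def has_field_derivative_def by auto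
  qed
  then show ?thesis
    using cont unfolding holomorphic_separately_def holomorphic_on_def
    by (blast intro: field_differentiable_at_within)
qed

lemma holomorphic_separately_compose_has_derivative:
  assumes f: "holomorphic_separately f S T" and ST: "open S" "open T"
    and L: "(L has_derivative L') (at p)" "(M has_derivative M') (at p)"
    and dom: "L p \<in> S" "M p \<in> T"
  shows "((\<lambda>p. f (L p) (M p)) has_derivative
    (\<lambda>v. deriv (\<lambda>w. f w (M p)) (L p) * L' v + deriv (f (L p)) (M p) * M' v)) (at p)"
  using has_derivative_compose[OF has_derivative_Pair[OF L]
      holomorphic_separately_has_derivative[OF f ST dom]] by simp

text \<open>Each directional derivative of the composite is a combination, with constant coefficients, of
composites of partial derivatives of \<open>f\<close>, which are again separately holomorphic; hence the
induction on the order.\<close>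

lemma holomorphic_separately_smooth:
  fixes L M :: "'a::real_normed_vector \<Rightarrow> complex"
  assumes ST: "open S" "open T"
    and L: "\<And>p. (L has_derivative L') (at p)" "\<And>p. (M has_derivative M') (at p)"
    and dom: "\<And>p. L p \<in> S" "\<And>p. M p \<in> T"
    and f: "holomorphic_separately f S T"
  shows "smooth (\<lambda>p. f (L p) (M p))"
proof -
  have "Ck n (\<lambda>p. f (L p) (M p))" for n
    using f
  proof (induction n arbitrary: f)
    case 0
    have "(\<lambda>p. f (L p) (M p)) differentiable (at p)" for p
      using holomorphic_separately_compose_has_derivative[OF 0 ST L dom] by (auto simp: differentiable_def)
    then show ?case
      by (auto intro!: continuous_at_imp_continuous_on differentiable_imp_continuous_within)
  next
    case (Suc n)
    show ?case
      by (rule Ck_SucI[OF holomorphic_separately_compose_has_derivative[OF Suc.prems ST L dom]];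
          intro Ck_add Ck_bilinear[OF bounded_bilinear_mult] Ck_const Suc.IH
            holomorphic_separately_deriv holomorphic_separately_deriv2 Suc.prems ST)
  qed
  then show ?thesis by (simp add: smooth_def)
qed

section \<open>Theta functions with prescribed zeros\<close>

definition euler_product :: "complex \<Rightarrow> complex \<Rightarrow> complex" where
  "euler_product q v = (\<Prod>n. 1 - q ^ n * v)"

lemma convergent_euler_product:
  fixes q v :: complex
  assumes "norm q < 1"
  shows "convergent_prod (\<lambda>n. 1 - q ^ n * v)"
proof (rule abs_convergent_prod_imp_convergent_prod, rule summable_imp_abs_convergent_prod)
  show "summable (\<lambda>n. norm (1 - q ^ n * v - 1))"
    using assms by (simp add: norm_mult norm_power summable_mult2 summable_geometric)
qed

text \<open>Splitting off the first factor: this functional equation is the source of the quasi-periodicity of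
the theta products and exhibits their zero at the origin.\<close>

lemma euler_product_step:
  assumes "norm q < 1"
  shows "euler_product q v = (1 - v) * euler_product q (q * v)"
proof (cases "v = 1")
  case True
  have "(\<Prod>n. 1 - q ^ n * v) = 0"
    using convergent_prod_has_prod[OF convergent_euler_product[OF assms, of v]] True
    by (subst has_prod_eq_0_iff) (auto intro: image_eqI[of _ _ 0])
  then show ?thesis using True by (simp add: euler_product_def)
next
  case False
  then show ?thesis
    using prodinf_split_head[OF convergent_euler_product[OF assms, of v]]
    by (simp add: euler_product_def mult_ac)
qed

lemma euler_product_nonzero:
  assumes "norm q < 1" "norm v < 1"
  shows "euler_product q v \<noteq> 0"
  unfolding euler_product_def
proof (rule prodinf_nonzero[OF convergent_euler_product[OF assms(1)]])
  fix n
  have "norm (q ^ n * v) \<le> 1 * norm v"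
    unfolding norm_mult norm_power using assms by (intro mult_right_mono power_le_one) auto
  then have "q ^ n * v \<noteq> 1" using assms(2) by auto
  then show "1 - q ^ n * v \<noteq> 0" by simp
qed

lemma holomorphic_euler_product:
  assumes q: "norm q < 1"
  shows "euler_product q holomorphic_on UNIV"
proof (rule holomorphic_uniform_sequence[OF open_UNIV])
  show "(\<lambda>v. \<Prod>n<N. 1 - q ^ n * v) holomorphic_on UNIV" for N
    by (intro holomorphic_intros)
  fix v :: complex
  have "uniformly_convergent_on (cball v 1) (\<lambda>N x. \<Prod>n<N. 1 - q ^ n * x)"
  proof (rule uniformly_convergent_on_prod'[OF _ compact_cball])
    show "uniformly_convergent_on (cball v 1) (\<lambda>N x. \<Sum>n<N. norm (1 - q ^ n * x - 1))"
    proof (rule Weierstrass_m_test')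
      show "summable (\<lambda>n. norm q ^ n * (norm v + 1))"
        using q by (simp add: summable_mult2 summable_geometric)
      show "norm (norm (1 - q ^ n * x - 1)) \<le> norm q ^ n * (norm v + 1)" if "x \<in> cball v 1" for n x
        using that norm_triangle_ineq2[of x v]
        by (auto simp: norm_mult norm_power dist_norm norm_minus_commute intro!: mult_left_mono)
    qed
  qed (auto intro!: continuous_intros)
  then obtain l where l: "uniform_limit (cball v 1) (\<lambda>N x. \<Prod>n<N. 1 - q ^ n * x) l sequentially"
    by (auto simp: uniformly_convergent_on_def)
  have "l x = euler_product q x" if "x \<in> cball v 1" for x
  proof (rule LIMSEQ_unique)
    show "(\<lambda>N. \<Prod>n<N. 1 - q ^ n * x) \<longlonglongrightarrow> l x"
      using tendsto_uniform_limitI[OF l that] .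
    have "(\<lambda>N. \<Prod>n<Suc N. 1 - q ^ n * x) \<longlonglongrightarrow> euler_product q x"
      using convergent_prod_LIMSEQ[OF convergent_euler_product[OF q, of x]]
      by (simp add: euler_product_def lessThan_Suc_atMost)
    then show "(\<lambda>N. \<Prod>n<N. 1 - q ^ n * x) \<longlonglongrightarrow> euler_product q x"
      by (rule LIMSEQ_imp_Suc)
  qed
  then have "uniform_limit (cball v 1) (\<lambda>N x. \<Prod>n<N. 1 - q ^ n * x) (euler_product q) sequentially"
    using uniform_limit_cong'[of "cball v 1"] l by (metis (no_types, lifting))
  then show "\<exists>d>0. cball v d \<subseteq> UNIV \<and>
      uniform_limit (cball v d) (\<lambda>N x. \<Prod>n<N. 1 - q ^ n * x) (euler_product q) sequentially"
    by (intro exI[of _ 1]) auto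
qed

text \<open>With \<open>q = exp (2\<pi>i\<tau>)\<close> and \<open>u = exp (2\<pi>iw)\<close> this is \<open>\<Prod>(1 - q\<^sup>n u) (1 - q\<^sup>n\<^sup>+\<^sup>1 / u)\<close>, which by the Jacobi
triple product is a constant multiple of the theta series \<open>\<Sum>(-1)\<^sup>m q\<^bsup>m(m-1)/2\<^esup> u\<^sup>m\<close>. The product shows
the zeros, which the series does not.\<close>

definition theta_product :: "complex \<Rightarrow> complex \<Rightarrow> complex" where
  "theta_product \<tau> w =
     euler_product (exp (2 * pi * \<i> * \<tau>)) (exp (2 * pi * \<i> * w)) *
     euler_product (exp (2 * pi * \<i> * \<tau>)) (exp (2 * pi * \<i> * (\<tau> - w)))"

lemma nome_norm: "Im \<tau> > 0 \<Longrightarrow> norm (exp (2 * pi * \<i> * \<tau>)) < 1"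
  by simp

lemma holomorphic_theta_product:
  assumes "Im \<tau> > 0"
  shows "theta_product \<tau> holomorphic_on A"
proof -
  have e: "(\<lambda>w. euler_product (exp (2 * pi * \<i> * \<tau>)) (g w)) holomorphic_on A" if "g holomorphic_on A" for g
    using holomorphic_on_compose_gen[OF that holomorphic_euler_product[OF nome_norm[OF assms]]]
    by (simp add: o_def)
  show ?thesis unfolding theta_product_def by (intro holomorphic_intros e)
qed

lemma holomorphic_theta_product_shift:
  assumes "Im \<tau> > 0"
  shows "(\<lambda>w. theta_product \<tau> (w - d)) holomorphic_on A"
proof -
  have "(\<lambda>w. w - d) holomorphic_on A" by (intro holomorphic_intros)
  from holomorphic_on_compose_gen[OF this holomorphic_theta_product[OF assms, of UNIV]]
  show ?thesis by (simp add: o_def)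
qed

lemma theta_product_period: "theta_product \<tau> (w + 1) = theta_product \<tau> w"
proof -
  have 1: "exp (2 * pi * \<i> * (w + 1)) = exp (2 * pi * \<i> * w)"
    by (simp add: ring_distribs exp_add)
  have "2 * pi * \<i> * (\<tau> - (w + 1)) = 2 * pi * \<i> * (\<tau> - w) - 2 * pi * \<i>"
    by (simp add: algebra_simps)
  then have "exp (2 * pi * \<i> * (\<tau> - (w + 1))) = exp (2 * pi * \<i> * (\<tau> - w))"
    by (simp only: exp_diff) simp
  with 1 show ?thesis by (simp add: theta_product_def)
qed

text \<open>The translation by \<open>\<tau>\<close> replaces \<open>u\<close> by \<open>qu\<close>: it removes the factor \<open>1 - u\<close> and adds the factor
\<open>1 - 1/u\<close>, and \<open>(1 - 1/u) / (1 - u) = - 1/u\<close>.\<close>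

lemma theta_product_quasi_period:
  assumes "Im \<tau> > 0"
  shows "theta_product \<tau> (w + \<tau>) = - exp (- 2 * pi * \<i> * w) * theta_product \<tau> w"
proof -
  define q u E where "q = exp (2 * pi * \<i> * \<tau>)" and "u = exp (2 * pi * \<i> * w)"
    and "E = euler_product q"
  have q: "norm q < 1" unfolding q_def by (rule nome_norm[OF assms])
  have u: "u \<noteq> 0" by (simp add: u_def)
  have e: "exp (2 * pi * \<i> * (w + \<tau>)) = q * u" "exp (2 * pi * \<i> * (\<tau> - (w + \<tau>))) = 1 / u"
    "exp (2 * pi * \<i> * (\<tau> - w)) = q * (1 / u)" "exp (- 2 * pi * \<i> * w) = 1 / u"
    by (simp_all add: q_def u_def ring_distribs exp_add exp_diff exp_minus field_simps)
  have "E (q * u) * E (1 / u) = (1 - 1 / u) * E (q * u) * E (q * (1 / u))"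
    unfolding E_def by (subst (2) euler_product_step[OF q]) simp
  also have "\<dots> = - (1 / u) * ((1 - u) * E (q * u)) * E (q * (1 / u))"
    using u by (simp add: field_simps)
  also have "(1 - u) * E (q * u) = E u"
    unfolding E_def by (rule euler_product_step[OF q, symmetric])
  finally show ?thesis
    unfolding theta_product_def e q_def[symmetric] u_def[symmetric] E_def[symmetric] by simp
qed

text \<open>Among all factors only \<open>1 - u\<close> vanishes at \<open>w = 0\<close>.\<close>

lemma theta_product_simple_zero:
  assumes "Im \<tau> > 0"
  shows "theta_product \<tau> 0 = 0" and "deriv (theta_product \<tau>) 0 \<noteq> 0"
proof -
  define q where "q = exp (2 * pi * \<i> * \<tau>)"
  have q: "norm q < 1" unfolding q_def by (rule nome_norm[OF assms])
  define G where "G = (\<lambda>w. euler_product q (q * exp (2 * pi * \<i> * w)) *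
      euler_product q (exp (2 * pi * \<i> * (\<tau> - w))))"
  have T: "theta_product \<tau> = (\<lambda>w. (1 - exp (2 * pi * \<i> * w)) * G w)"
  proof
    fix w
    show "theta_product \<tau> w = (1 - exp (2 * pi * \<i> * w)) * G w"
      unfolding theta_product_def G_def q_def[symmetric]
      by (subst euler_product_step[OF q, of "exp (2 * pi * \<i> * w)"]) (simp add: mult_ac)
  qed
  show "theta_product \<tau> 0 = 0" by (simp add: T)
  have e: "(\<lambda>w. euler_product q (g w)) holomorphic_on UNIV" if "g holomorphic_on UNIV" for g
    using holomorphic_on_compose_gen[OF that holomorphic_euler_product[OF q]] by (simp add: o_def)
  have "G holomorphic_on UNIV" unfolding G_def by (intro holomorphic_intros e)
  then have "(G has_field_derivative deriv G 0) (at 0)"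
    by (simp add: holomorphic_derivI)
  then have "(theta_product \<tau> has_field_derivative (- 2 * pi * \<i> * G 0)) (at 0)"
    unfolding T by (auto intro!: derivative_eq_intros)
  moreover have "G 0 \<noteq> 0"
    using euler_product_nonzero[OF q q] by (simp add: G_def q_def)
  ultimately show "deriv (theta_product \<tau>) 0 \<noteq> 0"
    by (simp add: DERIV_imp_deriv)
qed

lemma countable_zeros_theta_product:
  assumes "Im \<tau> > 0"
  shows "countable {w. theta_product \<tau> w = 0}"
proof -
  have "\<not> theta_product \<tau> constant_on UNIV"
  proof
    assume "theta_product \<tau> constant_on UNIV"
    then obtain c where "theta_product \<tau> = (\<lambda>w. c)" by (auto simp: constant_on_def)
    then show False using theta_product_simple_zero(2)[OF assms] by simp
  qed
  then show ?thesis
    using holomorphic_countable_zeros[OF holomorphic_theta_product[OF assms, of UNIV]]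
    by (simp add: connected_UNIV)
qed

text \<open>Each of the two conditions excludes only countably many values of \<open>b\<close>.\<close>

lemma theta_product_avoid_zeros:
  assumes t: "Im \<tau> > 0" and m: "m > 0"
  obtains b where "theta_product \<tau> (r - b) \<noteq> 0" "theta_product \<tau> (s + of_nat m * b) \<noteq> 0"
proof -
  let ?Z = "{w. theta_product \<tau> w = 0}"
  have "countable ((\<lambda>z. r - z) ` ?Z \<union> (\<lambda>z. (z - s) / of_nat m) ` ?Z)"
    using countable_zeros_theta_product[OF t] by auto
  then obtain b where b: "b \<notin> (\<lambda>z. r - z) ` ?Z \<union> (\<lambda>z. (z - s) / of_nat m) ` ?Z"
    using uncountable_UNIV_complex by (metis UNIV_eq_I)
  have "theta_product \<tau> (r - b) \<noteq> 0"
    using b by (force simp: image_iff)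
  moreover have "theta_product \<tau> (s + of_nat m * b) \<noteq> 0"
  proof
    assume z: "theta_product \<tau> (s + of_nat m * b) = 0"
    have "b = ((s + of_nat m * b) - s) / of_nat m" using m by simp
    then show False using b z by blast
  qed
  ultimately show ?thesis using that by blast
qed

text \<open>The \<open>k\<close> factors contribute \<open>(-1)\<^sup>k\<close> to the factor of automorphy, and the sum of the zeros \<open>a\<close>, \<open>b\<close>
(\<open>k - 2\<close> times) and \<open>c\<close> contributes \<open>exp (2\<pi>i k/2)\<close>. The two cancel.\<close>

lemma theta_product_in_theta_space:
  assumes t: "Im \<tau> > 0" and k: "k \<ge> 2" and abc: "a + of_nat (k - 2) * b + c = of_nat k / 2"
  shows "(\<lambda>w. theta_product \<tau> (w - a) * theta_product \<tau> (w - b) ^ (k - 2) * theta_product \<tau> (w - c))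
    \<in> theta_space k \<tau>" (is "?f \<in> _")
proof -
  note h = holomorphic_theta_product_shift[OF t, of _ UNIV]
  have 1: "theta_product \<tau> (w + 1 - d) = theta_product \<tau> (w - d)" for w d
    using theta_product_period[of \<tau> "w - d"] by (simp add: algebra_simps)
  have 2: "theta_product \<tau> (w + \<tau> - d) = - exp (- 2 * pi * \<i> * (w - d)) * theta_product \<tau> (w - d)" for w d
    using theta_product_quasi_period[OF t, of "w - d"] by (simp add: algebra_simps)
  have factor: "- exp (- 2 * pi * \<i> * (w - a)) * (- exp (- 2 * pi * \<i> * (w - b))) ^ (k - 2) *
      (- exp (- 2 * pi * \<i> * (w - c))) = exp (- 2 * of_real pi * \<i> * of_nat k * w)" for w
  proof -
    have neg: "- exp z = exp (\<i> * pi + z)" for z :: complex by (simp add: exp_add)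
    have kk: "of_nat (k - 2) = (of_nat k - 2 :: complex)" using k by (simp add: of_nat_diff)
    have "- exp (- 2 * pi * \<i> * (w - a)) * (- exp (- 2 * pi * \<i> * (w - b))) ^ (k - 2) *
      (- exp (- 2 * pi * \<i> * (w - c))) = exp ((\<i> * pi + - 2 * pi * \<i> * (w - a)) +
        of_nat (k - 2) * (\<i> * pi + - 2 * pi * \<i> * (w - b)) + (\<i> * pi + - 2 * pi * \<i> * (w - c)))"
      unfolding neg by (simp only: exp_of_nat_mult exp_add)
    also have "(\<i> * pi + - 2 * pi * \<i> * (w - a)) +
        of_nat (k - 2) * (\<i> * pi + - 2 * pi * \<i> * (w - b)) + (\<i> * pi + - 2 * pi * \<i> * (w - c)) =
        - 2 * of_real pi * \<i> * of_nat k * w + of_nat k * (\<i> * pi) +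
        2 * pi * \<i> * (a + of_nat (k - 2) * b + c)"
      unfolding kk by (simp add: algebra_simps)
    also have "\<dots> = - 2 * of_real pi * \<i> * of_nat k * w + of_nat k * (2 * pi * \<i>)"
      unfolding abc by (simp add: algebra_simps)
    also have "exp \<dots> = exp (- 2 * of_real pi * \<i> * of_nat k * w)"
      by (simp only: exp_add exp_of_nat_mult) simp
    finally show ?thesis .
  qed
  have "?f (w + \<tau>) = exp (- 2 * of_real pi * \<i> * of_nat k * w) * ?f w" for w
    unfolding factor[symmetric] 2 power_mult_distrib by (simp only: mult_ac)
  moreover have "?f holomorphic_on UNIV" by (intro holomorphic_intros h)
  ultimately show ?thesis
    using 1 by (auto simp: theta_space_def)
qed

text \<open>Here \<open>k - 1\<close> zeros are put at a generic point \<open>b\<close>; the condition on the sum determines the last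
one, which is then generic as well.\<close>

lemma theta_space_base_point_free:
  assumes t: "Im \<tau> > 0" and k: "k \<ge> 2"
  obtains f where "f \<in> theta_space k \<tau>" "f w \<noteq> 0"
proof -
  obtain b where b: "theta_product \<tau> (w - b) \<noteq> 0"
    "theta_product \<tau> ((w - of_nat k / 2) + of_nat (k - 1) * b) \<noteq> 0"
    using theta_product_avoid_zeros[OF t, of "k - 1"] k by auto
  define c where "c = of_nat k / 2 - of_nat (k - 1) * b"
  have "b + of_nat (k - 2) * b + c = of_nat k / 2"
    using k by (simp add: c_def of_nat_diff algebra_simps)
  moreover have wc: "w - c = (w - of_nat k / 2) + of_nat (k - 1) * b" by (simp add: c_def)
  have "theta_product \<tau> (w - c) \<noteq> 0" using b(2) unfolding wc .
  ultimately show ?thesis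
    using that[OF theta_product_in_theta_space[OF t, of k b b c]] b(1) k by simp
qed

text \<open>One zero is put at \<open>w\<close>, and \<open>k - 2 \<ge> 1\<close> zeros at a generic point \<open>b\<close>, so that the last zero also
avoids \<open>w\<close>. For \<open>k = 2\<close> there would be no freedom left: the second zero is determined by \<open>w\<close>.\<close>

lemma theta_space_simple_zero:
  assumes t: "Im \<tau> > 0" and k: "k \<ge> 3"
  obtains f where "f \<in> theta_space k \<tau>" "f w = 0" "deriv f w \<noteq> 0"
proof -
  obtain b where b: "theta_product \<tau> (w - b) \<noteq> 0"
    "theta_product \<tau> ((2 * w - of_nat k / 2) + of_nat (k - 2) * b) \<noteq> 0"
    using theta_product_avoid_zeros[OF t, of "k - 2"] k by auto
  define c where "c = of_nat k / 2 - w - of_nat (k - 2) * b"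
  have sum: "w + of_nat (k - 2) * b + c = of_nat k / 2" by (simp add: c_def)
  have wc: "w - c = (2 * w - of_nat k / 2) + of_nat (k - 2) * b" by (simp add: c_def)
  define g where "g = (\<lambda>x. theta_product \<tau> (x - b) ^ (k - 2) * theta_product \<tau> (x - c))"
  note h = holomorphic_theta_product_shift[OF t, of _ UNIV]
  have "g holomorphic_on UNIV" unfolding g_def by (intro holomorphic_intros h)
  then have dg: "(g has_field_derivative deriv g w) (at w)"
    by (simp add: holomorphic_derivI)
  have "(theta_product \<tau> has_field_derivative deriv (theta_product \<tau>) 0) (at (w - w))"
    using holomorphic_derivI[OF holomorphic_theta_product[OF t, of UNIV] open_UNIV] by simp
  then have "((\<lambda>x. theta_product \<tau> (x - w)) has_field_derivative deriv (theta_product \<tau>) 0) (at w)"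
    by (rule DERIV_chain'[THEN DERIV_cong, rotated]) (auto intro!: derivative_eq_intros)
  then have "((\<lambda>x. theta_product \<tau> (x - w) * g x) has_field_derivative
      deriv (theta_product \<tau>) 0 * g w) (at w)"
    by (rule DERIV_mult[OF _ dg, THEN DERIV_cong]) (simp add: theta_product_simple_zero[OF t])
  then have "deriv (\<lambda>x. theta_product \<tau> (x - w) * g x) w \<noteq> 0"
    using b wc theta_product_simple_zero(2)[OF t] by (simp add: DERIV_imp_deriv g_def)
  then show ?thesis
    using that[OF theta_product_in_theta_space[OF t _ sum]] k theta_product_simple_zero(1)[OF t]
    by (auto simp: g_def mult.assoc)
qed

lemma theta_family_in_theta_space:
  assumes "theta_family k \<theta>" "p \<in> {1..k}" "Im \<tau> > 0"
  shows "(\<lambda>w. \<theta> p w \<tau>) \<in> theta_space k \<tau>"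
  using assms cfun.span_base[of "\<lambda>w. \<theta> p w \<tau>" "(\<lambda>p w. \<theta> p w \<tau>) ` {1..k}"]
  unfolding theta_family_def by blast

lemma theta_family_holomorphic:
  assumes "theta_family k \<theta>" "p \<in> {1..k}" "Im \<tau> > 0"
  shows "(\<lambda>w. \<theta> p w \<tau>) holomorphic_on UNIV"
  using theta_family_in_theta_space[OF assms] by (simp add: theta_space_def)

text \<open>Vanishing at \<open>w\<close> is a linear condition, so it would pass from the basis to the whole space.\<close>

lemma theta_family_base_point_free:
  assumes th: "theta_family k \<theta>" and k: "k \<ge> 2" and t: "Im \<tau> > 0"
  shows "\<exists>p\<in>{1..k}. \<theta> p w \<tau> \<noteq> 0"
proof (rule ccontr)
  assume neg: "\<not> ?thesis"
  obtain f where f: "f \<in> theta_space k \<tau>" "f w \<noteq> 0"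
    using theta_space_base_point_free[OF t k] .
  have "cfun.span ((\<lambda>p w. \<theta> p w \<tau>) ` {1..k}) \<subseteq> {f. f w = 0}"
    by (rule cfun.span_minimal) (use neg in \<open>auto simp: cfun.subspace_def\<close>)
  then show False
    using f th t by (auto simp: theta_family_def)
qed

text \<open>The condition \<open>f' w = c * f w\<close> is linear in \<open>f\<close>, so it would pass from the basis to the whole space,
which contains a function with a simple zero at \<open>w\<close>. Together with the absence of common zeros this
says that the vectors of values and of derivatives of the basis are linearly independent.\<close>

lemma theta_family_immersive:
  assumes th: "theta_family k \<theta>" and k: "k \<ge> 3" and t: "Im \<tau> > 0"
  shows "\<not> (\<forall>p\<in>{1..k}. deriv (\<lambda>w. \<theta> p w \<tau>) w = c * \<theta> p w \<tau>)"
proof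
  assume eq: "\<forall>p\<in>{1..k}. deriv (\<lambda>w. \<theta> p w \<tau>) w = c * \<theta> p w \<tau>"
  obtain f where f: "f \<in> theta_space k \<tau>" "f w = 0" "deriv f w \<noteq> 0"
    using theta_space_simple_zero[OF t k] .
  have "cfun.span ((\<lambda>p w. \<theta> p w \<tau>) ` {1..k}) \<subseteq>
      {f. (f has_field_derivative c * f w) (at w)}"
  proof (rule cfun.span_minimal)
    show "(\<lambda>p w. \<theta> p w \<tau>) ` {1..k} \<subseteq> {f. (f has_field_derivative c * f w) (at w)}"
    proof (intro subsetI, elim imageE, intro CollectI)
      fix f p assume p: "f = (\<lambda>w. \<theta> p w \<tau>)" "p \<in> {1..k}"
      show "(f has_field_derivative c * f w) (at w)"
        using holomorphic_derivI[OF theta_family_holomorphic[OF th p(2) t] open_UNIV UNIV_I, of w]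
          eq p by simp
    qed
    show "cfun.subspace {f. (f has_field_derivative c * f w) (at w)}"
      unfolding cfun.subspace_def
    proof (intro conjI ballI allI CollectI; (elim CollectE)?)
      show "((0 :: complex \<Rightarrow> complex) has_field_derivative c * 0 w) (at w)"
        by (simp add: zero_fun_def)
      show "(x + y has_field_derivative c * (x + y) w) (at w)"
        if "(x has_field_derivative c * x w) (at w)" "(y has_field_derivative c * y w) (at w)" for x y
        using DERIV_add[OF that] by (simp add: plus_fun_def algebra_simps)
      show "((\<lambda>w. a * x w) has_field_derivative c * (a * x w)) (at w)"
        if "(x has_field_derivative c * x w) (at w)" for a x
        using DERIV_cmult[OF that, of a] by (simp add: algebra_simps)
    qed
  qed
  then have "(f has_field_derivative c * f w) (at w)"
    using f(1) th t by (auto simp: theta_family_def)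
  then show False using f by (simp add: DERIV_imp_deriv)
qed

section \<open>The Kodaira--Thurston group\<close>

text \<open>All elements of the group have this form, with integer parameters; real parameters are enough for
computing derivatives. It is written as a sum so that the linear part is visible.\<close>

definition kt_map :: "real \<Rightarrow> real \<Rightarrow> real \<Rightarrow> real \<Rightarrow> real^4 \<Rightarrow> real^4" where
  "kt_map l m n r p = p + (l * p$2) *\<^sub>R axis 3 1 + vector [l, m, n, r]"

lemma vector_4_nth [simp]:
  "(vector [a, b, c, d] :: real^4) $ 1 = a" "(vector [a, b, c, d] :: real^4) $ 2 = b"
  "(vector [a, b, c, d] :: real^4) $ 3 = c" "(vector [a, b, c, d] :: real^4) $ 4 = d"
  by (simp_all add: vector_def)

lemma kt_map_component [simp]:
  "kt_map l m n r p $ 1 = p$1 + l" "kt_map l m n r p $ 2 = p$2 + m"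
  "kt_map l m n r p $ 3 = p$3 + l * p$2 + n" "kt_map l m n r p $ 4 = p$4 + r"
  by (simp_all add: kt_map_def axis_def)

lemma kt_generators_eq_kt_map:
  "kt_a = kt_map 1 0 0 0" "kt_b = kt_map 0 1 0 0" "kt_c = kt_map 0 0 1 0" "kt_d = kt_map 0 0 0 1"
  by (auto simp: fun_eq_iff vec_eq_iff forall_4)

lemma kt_map_has_derivative:
  "(kt_map l m n r has_derivative (\<lambda>v. v + (l * v$2) *\<^sub>R axis 3 1)) (at p)"
  unfolding kt_map_def by (auto intro!: derivative_eq_intros bounded_linear.has_derivative[OF bounded_linear_vec_nth])

lemma kt_map_differentiable: "kt_map l m n r differentiable (at p)"
  unfolding differentiable_def by (rule exI, rule kt_map_has_derivative)

lemma kt_generator_cases: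
  assumes "h \<in> {kt_a, kt_b, kt_c, kt_d}"
  obtains l m n r where "h = kt_map l m n r"
  using assms kt_generators_eq_kt_map by blast

lemma kt_generator_differentiable: "h \<in> {kt_a, kt_b, kt_c, kt_d} \<Longrightarrow> h differentiable (at p)"
  by (elim kt_generator_cases) (simp add: kt_map_differentiable)

lemma kt_map_compose: "kt_map l m n r \<circ> kt_map l' m' n' r' = kt_map (l + l') (m + m') (n + n' + l * m') (r + r')"
  by (auto simp: fun_eq_iff vec_eq_iff forall_4 algebra_simps)

lemma kt_map_0: "kt_map 0 0 0 0 = id"
  by (auto simp: fun_eq_iff vec_eq_iff forall_4)

lemma inv_BijGroup_kt_map:
  assumes "h \<in> {kt_a, kt_b, kt_c, kt_d}" and h: "h = kt_map l m n r"
  shows "inv\<^bsub>BijGroup UNIV\<^esub> h = kt_map (- l) (- m) (l * m - n) (- r)" (is "_ = ?h'")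
proof -
  interpret G: group "BijGroup (UNIV :: (real^4) set)" by (rule group_BijGroup)
  have hc: "h \<in> carrier (BijGroup UNIV)" using assms kt_Bij by blast
  have c: "?h' \<circ> h = id" "h \<circ> ?h' = id"
    unfolding h kt_map_compose by (simp_all add: kt_map_0)
  then have "bij ?h'" using o_bij by blast
  then have h'c: "?h' \<in> carrier (BijGroup UNIV)" by (simp add: BijGroup_def Bij_def)
  have "?h' \<otimes>\<^bsub>BijGroup UNIV\<^esub> h = \<one>\<^bsub>BijGroup UNIV\<^esub>"
    using c(1) BijGroup_UNIV_mult[OF h'c hc] by (auto simp: fun_eq_iff BijGroup_def)
  then show ?thesis by (rule G.inv_equality[OF _ hc h'c])
qed

text \<open>An induction principle that replaces the group structure on bijections by composition of maps.\<close>

lemma KT_group_induct [consumes 1, case_names id generator inverse compose]: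
  assumes g: "g \<in> KT_group"
    and id: "P id"
    and gen: "\<And>h. h \<in> {kt_a, kt_b, kt_c, kt_d} \<Longrightarrow> P h"
    and inv: "\<And>h l m n r. h \<in> {kt_a, kt_b, kt_c, kt_d} \<Longrightarrow> h \<circ> kt_map l m n r = id \<Longrightarrow> P (kt_map l m n r)"
    and comp: "\<And>g h. g \<in> KT_group \<Longrightarrow> h \<in> KT_group \<Longrightarrow> P g \<Longrightarrow> P h \<Longrightarrow> P (g \<circ> h)"
  shows "P g"
proof -
  interpret G: group "BijGroup (UNIV :: (real^4) set)" by (rule group_BijGroup)
  show ?thesis using g unfolding KT_group_def
  proof (induction rule: generate.induct)
    case one
    have "\<one>\<^bsub>BijGroup UNIV\<^esub> = (id :: real^4 \<Rightarrow> _)" by (auto simp: BijGroup_def fun_eq_iff)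
    then show ?case using id by (simp only:)
  next
    case (incl h)
    then show ?case by (rule gen)
  next
    case (inv h)
    then obtain l m n r where h: "h = kt_map l m n r" by (rule kt_generator_cases)
    have "h \<circ> kt_map (- l) (- m) (l * m - n) (- r) = id"
      unfolding h kt_map_compose by (simp add: kt_map_0)
    then show ?case
      unfolding inv_BijGroup_kt_map[OF inv h] by (rule assms(4)[OF inv])
  next
    case (eng g h)
    have "g \<otimes>\<^bsub>BijGroup UNIV\<^esub> h = g \<circ> h"
      using BijGroup_UNIV_mult[OF G.generate_in_carrier[OF kt_Bij eng(1)]
          G.generate_in_carrier[OF kt_Bij eng(2)]] by (auto simp: fun_eq_iff)
    then show ?case using comp eng by (simp only: KT_group_def)
  qed
qed

lemma KT_group_kt_map:
  assumes "g \<in> KT_group"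
  obtains l m n r where "g = kt_map l m n r"
proof -
  have "\<exists>l m n r. g = kt_map l m n r" using assms
  proof (induction rule: KT_group_induct)
    case id
    then show ?case using kt_map_0 by metis
  next
    case (generator h)
    then show ?case by (metis kt_generator_cases)
  next
    case (compose g h)
    then show ?case by (metis kt_map_compose)
  qed blast
  then show ?thesis using that by blast
qed

lemma KT_group_differentiable: "g \<in> KT_group \<Longrightarrow> g differentiable (at p)"
  by (elim KT_group_kt_map) (simp add: kt_map_differentiable)

lemma pullback1_compose:
  assumes "\<And>p. g differentiable (at p)" "\<And>p. h differentiable (at p)"
  shows "pullback1 (g \<circ> h) \<beta> = pullback1 h (pullback1 g \<beta>)"
  using frechet_derivative_compose[OF assms(2) assms(1)]
  by (simp add: pullback1_def fun_eq_iff)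

lemma pullback1_id: "pullback1 id \<beta> = \<beta>"
  by (simp add: pullback1_def fun_eq_iff)

lemma pullback1_KT_group_invariant:
  assumes gen: "\<And>h. h \<in> {kt_a, kt_b, kt_c, kt_d} \<Longrightarrow> pullback1 h \<beta> = \<beta>" and g: "g \<in> KT_group"
  shows "pullback1 g \<beta> = \<beta>"
  using g
proof (induction rule: KT_group_induct)
  case id
  show ?case by (rule pullback1_id)
next
  case (generator h)
  then show ?case by (rule gen)
next
  case (inverse h l m n r)
  have "pullback1 (kt_map l m n r) \<beta> = pullback1 (kt_map l m n r) (pullback1 h \<beta>)"
    unfolding gen[OF inverse(1)] ..
  also have "\<dots> = pullback1 (h \<circ> kt_map l m n r) \<beta>"
    by (rule pullback1_compose[symmetric])
       (rule kt_generator_differentiable[OF inverse(1)], rule kt_map_differentiable)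
  finally show ?case by (simp add: inverse(2) pullback1_id)
next
  case (compose g h)
  have "pullback1 (g \<circ> h) \<beta> = pullback1 h (pullback1 g \<beta>)"
    by (intro pullback1_compose KT_group_differentiable compose.hyps)
  then show ?case by (simp only: compose.IH)
qed

lemma KT_proj_invariant:
  assumes g: "g \<in> KT_group"
  shows "KT_proj (g p) = KT_proj p"
proof -
  interpret G: group "BijGroup (UNIV :: (real^4) set)" by (rule group_BijGroup)
  have car: "h \<in> carrier (BijGroup UNIV)" if "h \<in> KT_group" for h
    using that unfolding KT_group_def by (rule G.generate_in_carrier[OF kt_Bij])
  have comp: "h \<circ> h' \<in> KT_group" if "h \<in> KT_group" "h' \<in> KT_group" for h h'
  proof -
    have "h \<otimes>\<^bsub>BijGroup UNIV\<^esub> h' = h \<circ> h'"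
      using BijGroup_UNIV_mult[OF car car, OF that] by (auto simp: fun_eq_iff)
    then show ?thesis using that unfolding KT_group_def by (metis generate.eng)
  qed
  define g' where "g' = inv\<^bsub>BijGroup UNIV\<^esub> g"
  have g': "g' \<in> KT_group"
    using G.generate_m_inv_closed[OF kt_Bij] g unfolding KT_group_def g'_def by blast
  have "g' (g q) = q" for q
    using BijGroup_UNIV_mult[OF car car, OF g' g, of q] G.l_inv[OF car[OF g]]
    by (simp add: g'_def BijGroup_def)
  then have "g' (g p) = p" .
  then have "h p \<in> KT_proj (g p)" if "h \<in> KT_group" for h
    unfolding KT_proj_def using comp[OF that g'] by (intro CollectI exI[of _ "h \<circ> g'"]) simp
  moreover have "h (g p) \<in> KT_proj p" if "h \<in> KT_group" for h
    unfolding KT_proj_def using comp[OF that g] by (intro CollectI exI[of _ "h \<circ> g"]) simp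
  ultimately show ?thesis
    by (auto simp: KT_proj_def)
qed

text \<open>The form \<open>c (x dz - x\<^sup>2/2 dy + t dy - dz/2)\<close>. The first three terms are a primitive of \<open>-c \<omega>\<close>;
the closed form \<open>- c dz/2\<close> is added because the first three terms change under \<open>a\<close> by
\<open>c (dz + dy/2)\<close>, whereas only \<open>c dz\<close> is needed.\<close>

definition KT_correction :: "real \<Rightarrow> (real^4) form1" where
  "KT_correction c p v = c * (p$1 * v$3 - (p$1)\<^sup>2 / 2 * v$2 + p$4 * v$2 - v$3 / 2)"

lemma smooth_form1_KT_correction: "smooth_form1 (KT_correction c)"
proof -
  have "linear (KT_correction c p)" for p
    by (rule linearI) (simp_all add: KT_correction_def algebra_simps add_divide_distrib)
  moreover have "smooth (\<lambda>p. KT_correction c p v)" for v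
    unfolding KT_correction_def power2_eq_square divide_inverse
    by (intro smooth_add smooth_diff smooth_mult smooth_const smooth_component)
  ultimately show ?thesis by (simp add: smooth_form1_def)
qed

lemma ext_d1_KT_correction: "ext_d1 (KT_correction c) p u v = - c * omega_KT p u v"
proof -
  have "((\<lambda>p. KT_correction c p v) has_derivative
      (\<lambda>u. c * (u$1 * v$3 - p$1 * u$1 * v$2 + u$4 * v$2))) (at p)" for v p
    unfolding KT_correction_def
    by (rule derivative_eq_intros bounded_linear.has_derivative[OF bounded_linear_vec_nth] refl | simp)+
       (simp add: algebra_simps)
  from frechet_derivative_eqI[OF this] show ?thesis
    by (simp add: ext_d1_def omega_KT_def wedge_def dcoord_def algebra_simps)
qed

lemma KT_closed_form2_omega_KT: "KT_closed_form2 (\<lambda>p u v. c * omega_KT p u v)"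
proof -
  have eq: "(\<lambda>p u v. c * omega_KT p u v) = ext_d1 (KT_correction (- c))"
    by (simp add: fun_eq_iff ext_d1_KT_correction)
  have "pullback2 g (\<lambda>p u v. c * omega_KT p u v) = (\<lambda>p u v. c * omega_KT p u v)" if g: "g \<in> KT_group" for g
  proof -
    from g obtain l m n r where g_eq: "g = kt_map l m n r" by (rule KT_group_kt_map)
    show ?thesis unfolding g_eq
      by (simp add: fun_eq_iff pullback2_def frechet_derivative_eqI[OF kt_map_has_derivative]
          omega_KT_def wedge_def dcoord_def axis_def algebra_simps)
  qed
  moreover have "smooth_form2 (\<lambda>p u v. c * omega_KT p u v)"
    "\<forall>p u v w. ext_d2 (\<lambda>p u v. c * omega_KT p u v) p u v w = 0"
    unfolding eq by (simp_all add: smooth_form2_ext_d1 ext_d2_ext_d1 smooth_form1_KT_correction)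
  ultimately show ?thesis by (simp add: KT_closed_form2_def KT_form2_def)
qed

section \<open>The Fubini--Study form in homogeneous coordinates\<close>

text \<open>The Hermitian product for vectors indexed by an arbitrary finite set. Functions are used instead of
\<open>complex^'n\<close> so that the sets \<open>{1..k}\<close> and \<open>{1..k} \<times> {1..k}\<close> can serve as index sets.\<close>

definition hdot :: "'i set \<Rightarrow> ('i \<Rightarrow> complex) \<Rightarrow> ('i \<Rightarrow> complex) \<Rightarrow> complex" where
  "hdot I a b = (\<Sum>i\<in>I. a i * cnj (b i))"

lemma hdot_add_left: "hdot I (\<lambda>i. a i + b i) c = hdot I a c + hdot I b c"
  and hdot_add_right: "hdot I c (\<lambda>i. a i + b i) = hdot I c a + hdot I c b"
  and hdot_scale_left: "hdot I (\<lambda>i. s * a i) c = s * hdot I a c"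
  and hdot_scale_right: "hdot I c (\<lambda>i. s * a i) = cnj s * hdot I c a"
  by (simp_all add: hdot_def algebra_simps sum.distrib sum_distrib_left)

lemmas hdot_simps = hdot_add_left hdot_add_right hdot_scale_left hdot_scale_right

lemma cnj_hdot: "cnj (hdot I a b) = hdot I b a"
  by (simp add: hdot_def mult.commute)

lemma hdot_self: "hdot I a a = of_real (\<Sum>i\<in>I. (cmod (a i))\<^sup>2)"
  unfolding hdot_def of_real_sum complex_norm_square ..

lemma hdot_self_nonzero:
  assumes "finite I" "i \<in> I" "a i \<noteq> 0"
  shows "(\<Sum>i\<in>I. (cmod (a i))\<^sup>2) > 0" "hdot I a a \<noteq> 0"
proof -
  show *: "(\<Sum>i\<in>I. (cmod (a i))\<^sup>2) > 0"
    using assms by (intro sum_pos2[of I i]) auto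
  then show "hdot I a a \<noteq> 0" unfolding hdot_self of_real_eq_0_iff by simp
qed

text \<open>The Hermitian form \<open>\<Sum> (\<partial>\<^sup>2 log |x|\<^sup>2 / \<partial>x\<^sub>i \<partial>cnj x\<^sub>j) a\<^sub>i cnj b\<^sub>j\<close>, which is the Fubini--Study metric at
the point \<open>[x]\<close> up to a constant.\<close>

definition fs_herm :: "'i set \<Rightarrow> ('i \<Rightarrow> complex) \<Rightarrow> ('i \<Rightarrow> complex) \<Rightarrow> ('i \<Rightarrow> complex) \<Rightarrow> complex" where
  "fs_herm I x a b = hdot I a b / hdot I x x - hdot I a x * hdot I x b / (hdot I x x)\<^sup>2"

lemma cnj_fs_herm: "cnj (fs_herm I x a b) = fs_herm I x b a"
  by (simp add: fs_herm_def cnj_hdot mult.commute)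

lemma fs_herm_scale: "fs_herm I x (\<lambda>i. s * a i) (\<lambda>i. t * b i) = s * cnj t * fs_herm I x a b"
  by (simp add: fs_herm_def hdot_simps algebra_simps)

text \<open>If \<open>x\<close> is replaced by \<open>c * x\<close> with a variable factor \<open>c\<close>, its derivatives acquire a component in the
direction of \<open>x\<close>, which is in the kernel of the form. So the choice of homogeneous coordinates does
not matter.\<close>

lemma fs_herm_homogeneous:
  assumes c: "c \<noteq> 0" and x: "hdot I x x \<noteq> 0"
  shows "fs_herm I (\<lambda>i. c * x i) (\<lambda>i. \<alpha> * x i + c * a i) (\<lambda>i. \<beta> * x i + c * b i) = fs_herm I x a b"
proof -
  have c': "cnj c \<noteq> 0" using c by simp
  show ?thesis
    using c c' x unfolding fs_herm_def hdot_simps power2_eq_square by (simp add: field_simps)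
qed

text \<open>The value is the squared length of the component of \<open>a\<close> orthogonal to \<open>x\<close>, divided by that of \<open>x\<close>.\<close>

lemma fs_herm_positive:
  assumes I: "finite I" and x: "i \<in> I" "x i \<noteq> 0" and a: "\<And>c. \<not> (\<forall>i\<in>I. a i = c * x i)"
  obtains h where "h > 0" "fs_herm I x a a = of_real h"
proof -
  have N: "hdot I x x \<noteq> 0" "(\<Sum>i\<in>I. (cmod (x i))\<^sup>2) > 0" using hdot_self_nonzero[of I i x] I x by auto
  define c where "c = hdot I a x / hdot I x x"
  define b where "b = (\<lambda>i. a i + (- c) * x i)"
  obtain j where "j \<in> I" "b j \<noteq> 0" using a[of c] by (auto simp: b_def)
  then have b: "(\<Sum>i\<in>I. (cmod (b i))\<^sup>2) > 0" using hdot_self_nonzero[of I j b] I by auto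
  have "hdot I b b / hdot I x x = fs_herm I x a a"
    using N unfolding b_def hdot_simps fs_herm_def c_def
    by (simp add: field_simps power2_eq_square cnj_hdot)
  then have "fs_herm I x a a = of_real ((\<Sum>i\<in>I. (cmod (b i))\<^sup>2) / (\<Sum>i\<in>I. (cmod (x i))\<^sup>2))"
    by (simp add: hdot_self)
  then show ?thesis using that b N(2) by (meson divide_pos_pos)
qed

lemma wirtinger_bar_log_norm:
  fixes W :: "complex^'n::finite"
  assumes "W \<noteq> 0"
  shows "wirtinger_bar j (\<lambda>W. of_real (ln (W \<bullet> W))) W = W $ j / of_real (W \<bullet> W)"
proof -
  have pos: "W \<bullet> W > 0" using assms by simp
  have "((\<lambda>W. of_real (ln (W \<bullet> W)) :: complex) has_derivative
      (\<lambda>h. of_real (2 * (W \<bullet> h) / (W \<bullet> W)))) (at W)"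
    using pos by (auto intro!: derivative_eq_intros simp: inner_commute field_simps)
  from frechet_derivative_eqI[OF this] show ?thesis
    using pos by (simp add: wirtinger_bar_def inner_axis inner_complex_def complex_eq_iff field_simps)
qed

lemma wirtinger_wirtinger_bar_log_norm:
  fixes Z :: "complex^'n::finite"
  assumes Z: "Z \<noteq> 0"
  shows "wirtinger i (wirtinger_bar j (\<lambda>W. of_real (ln (W \<bullet> W)))) Z =
    (if i = j then 1 / of_real (Z \<bullet> Z) else 0) - Z $ j * cnj (Z $ i) / (of_real (Z \<bullet> Z))\<^sup>2"
proof -
  have pos: "Z \<bullet> Z > 0" using Z by simp
  then have nz: "of_real (Z \<bullet> Z) \<noteq> (0 :: complex)" by simp
  have d: "((\<lambda>W. W $ j / of_real (W \<bullet> W)) has_derivative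
      (\<lambda>h. h $ j / of_real (Z \<bullet> Z) - Z $ j * of_real (2 * (Z \<bullet> h)) / (of_real (Z \<bullet> Z))\<^sup>2)) (at Z)"
    by (rule derivative_eq_intros bounded_linear.has_derivative[OF bounded_linear_vec_nth] refl nz)+
       (use nz in \<open>simp add: fun_eq_iff inner_commute field_simps power2_eq_square\<close>)
  have "frechet_derivative (wirtinger_bar j (\<lambda>W. of_real (ln (W \<bullet> W)))) (at Z) =
      frechet_derivative (\<lambda>W. W $ j / of_real (W \<bullet> W)) (at Z)"
    by (rule frechet_derivative_transform_within_open[symmetric, where X = "- {0}"])
       (use d Z in \<open>auto simp: differentiable_def wirtinger_bar_log_norm\<close>)
  also have "\<dots> = (\<lambda>h. h $ j / of_real (Z \<bullet> Z) - Z $ j * of_real (2 * (Z \<bullet> h)) / (of_real (Z \<bullet> Z))\<^sup>2)"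
    by (rule frechet_derivative_eqI[OF d])
  finally have fd: "frechet_derivative (wirtinger_bar j (\<lambda>W. of_real (ln (W \<bullet> W)))) (at Z) =
     (\<lambda>h. h $ j / of_real (Z \<bullet> Z) - Z $ j * of_real (2 * (Z \<bullet> h)) / (of_real (Z \<bullet> Z))\<^sup>2)" .
  have c: "cnj (Z $ i) = of_real (Re (Z $ i)) - \<i> * of_real (Im (Z $ i))"
    by (simp add: complex_eq_iff)
  have ax: "Z \<bullet> axis i 1 = Re (Z $ i)" "Z \<bullet> axis i \<i> = Im (Z $ i)"
    "axis i a $ j = (if i = j then a else 0)" for a :: complex
    by (simp_all add: inner_axis inner_complex_def) (simp add: axis_def)
  show ?thesis
    unfolding wirtinger_def fd c ax
    using nz by (cases "i = j") (simp_all add: field_simps)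
qed

text \<open>The form \<open>\<partial>\<partial>\<^sup>- log |Z|\<^sup>2\<close> is the Hermitian form minus its conjugate, that is \<open>2i\<close> times its imaginary
part.\<close>

lemma fubini_study_eq_fs_herm:
  fixes Z :: "complex^'n::finite"
  assumes Z: "Z \<noteq> 0"
  shows "fubini_study Z u v = - Im (fs_herm UNIV (($) Z) (($) u) (($) v)) / pi"
proof -
  have norm_eq: "(\<Sum>j\<in>UNIV. (cmod (W $ j))\<^sup>2) = W \<bullet> W" for W :: "complex^'n"
    by (simp add: inner_vec_def power2_norm_eq_inner)
  define N :: complex where "N = of_real (Z \<bullet> Z)"
  have N: "hdot UNIV (($) Z) (($) Z) = N"
    by (simp add: hdot_self norm_eq N_def)
  let ?P = "\<lambda>u v. fs_herm UNIV (($) Z) (($) u) (($) v)"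
  have herm: "(\<Sum>i\<in>UNIV. \<Sum>j\<in>UNIV. ((if i = j then 1 / N else 0) - Z $ j * cnj (Z $ i) / N\<^sup>2) *
      (u $ i * cnj (v $ j))) = ?P u v" for u v
  proof -
    have "(\<Sum>i\<in>UNIV. \<Sum>j\<in>UNIV. ((if i = j then 1 / N else 0) - Z $ j * cnj (Z $ i) / N\<^sup>2) *
        (u $ i * cnj (v $ j))) =
      (\<Sum>i\<in>UNIV. \<Sum>j\<in>UNIV. (if i = j then u $ i * cnj (v $ j) / N else 0)) -
      (\<Sum>i\<in>UNIV. \<Sum>j\<in>UNIV. (u $ i * cnj (Z $ i)) * (Z $ j * cnj (v $ j)) / N\<^sup>2)"
      unfolding sum_subtractf[symmetric] by (intro sum.cong refl) (simp add: algebra_simps)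
    also have "(\<Sum>i\<in>UNIV. \<Sum>j\<in>UNIV. (u $ i * cnj (Z $ i)) * (Z $ j * cnj (v $ j)) / N\<^sup>2) =
        hdot UNIV (($) u) (($) Z) * hdot UNIV (($) Z) (($) v) / N\<^sup>2"
      unfolding hdot_def sum_product sum_divide_distrib ..
    finally show ?thesis
      by (simp add: fs_herm_def N) (simp add: hdot_def sum_divide_distrib)
  qed
  have "ddbar (\<lambda>W. of_real (ln (\<Sum>j\<in>UNIV. (cmod (W$j))\<^sup>2))) Z u v =
     (\<Sum>i\<in>UNIV. \<Sum>j\<in>UNIV. ((if i = j then 1 / N else 0) - Z $ j * cnj (Z $ i) / N\<^sup>2) * (u $ i * cnj (v $ j))) -
     (\<Sum>i\<in>UNIV. \<Sum>j\<in>UNIV. ((if i = j then 1 / N else 0) - Z $ j * cnj (Z $ i) / N\<^sup>2) * (v $ i * cnj (u $ j)))"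
    unfolding ddbar_def norm_eq wirtinger_wirtinger_bar_log_norm[OF Z] N_def[symmetric]
      sum_subtractf[symmetric] right_diff_distrib[symmetric] ..
  also have "\<dots> = ?P u v - cnj (?P u v)"
    unfolding herm cnj_fs_herm ..
  finally show ?thesis
    unfolding fubini_study_def by (simp add: complex_diff_cnj field_simps)
qed

text \<open>The pullback along \<open>X\<close> of the form \<open>v \<mapsto> Im (\<langle>v, Z\<rangle> / \<langle>Z, Z\<rangle>) / 2\<pi>\<close>, which is
\<open>d\<^sup>c log |Z|\<^sup>2 / 4\<pi>\<close> for \<open>d\<^sup>c = i(\<partial>\<^sup>- - \<partial>)\<close>.\<close>

definition log_norm_form :: "'i set \<Rightarrow> ('i \<Rightarrow> 'a::real_normed_vector \<Rightarrow> complex) \<Rightarrow> 'a form1" where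
  "log_norm_form I X p v = Im (hdot I (\<lambda>i. frechet_derivative (X i) (at p) v) (\<lambda>i. X i p) /
     hdot I (\<lambda>i. X i p) (\<lambda>i. X i p)) / (2 * pi)"

lemma smooth_cnj: "smooth f \<Longrightarrow> smooth (\<lambda>p. cnj (f p))"
  by (rule smooth_bounded_linear[OF bounded_linear_cnj])

lemma smooth_hdot:
  assumes "\<And>i. i \<in> I \<Longrightarrow> smooth (X i)" "\<And>i. i \<in> I \<Longrightarrow> smooth (Y i)"
  shows "smooth (\<lambda>p. hdot I (\<lambda>i. X i p) (\<lambda>i. Y i p))"
  unfolding hdot_def by (intro smooth_sum smooth_mult smooth_cnj assms)

lemma frechet_derivative_hdot:
  assumes "\<And>i. i \<in> I \<Longrightarrow> smooth (X i)" "\<And>i. i \<in> I \<Longrightarrow> smooth (Y i)"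
  shows "((\<lambda>p. hdot I (\<lambda>i. X i p) (\<lambda>i. Y i p)) has_derivative
    (\<lambda>v. hdot I (\<lambda>i. frechet_derivative (X i) (at p) v) (\<lambda>i. Y i p) +
         hdot I (\<lambda>i. X i p) (\<lambda>i. frechet_derivative (Y i) (at p) v))) (at p)"
proof -
  have "((\<lambda>p. \<Sum>i\<in>I. X i p * cnj (Y i p)) has_derivative
    (\<lambda>v. \<Sum>i\<in>I. X i p * cnj (frechet_derivative (Y i) (at p) v) + frechet_derivative (X i) (at p) v * cnj (Y i p))) (at p)"
    by (intro has_derivative_sum has_derivative_mult has_derivative_cnj smooth_has_derivative assms)
  then show ?thesis
    by (simp add: hdot_def sum.distrib add.commute)
qed

lemma smooth_form1_log_norm_form:
  assumes X: "\<And>i. i \<in> I \<Longrightarrow> smooth (X i)" and nz: "\<And>p. hdot I (\<lambda>i. X i p) (\<lambda>i. X i p) \<noteq> 0"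
  shows "smooth_form1 (log_norm_form I X)"
proof -
  have lin: "linear (frechet_derivative (X i) (at p))" if "i \<in> I" for i p
    using smooth_has_derivative[OF X[OF that]] has_derivative_linear by blast
  have h_add: "hdot I (\<lambda>i. frechet_derivative (X i) (at p) (v + w)) y =
      hdot I (\<lambda>i. frechet_derivative (X i) (at p) v) y + hdot I (\<lambda>i. frechet_derivative (X i) (at p) w) y" for p v w y
    unfolding hdot_add_left[symmetric] unfolding hdot_def by (intro sum.cong refl) (simp add: linear_add[OF lin])
  have h_scale: "hdot I (\<lambda>i. frechet_derivative (X i) (at p) (r *\<^sub>R v)) y =
      of_real r * hdot I (\<lambda>i. frechet_derivative (X i) (at p) v) y" for p v r y
    unfolding hdot_scale_left[symmetric] unfolding hdot_def
    by (intro sum.cong refl) (simp add: linear_cmul[OF lin] scaleR_conv_of_real)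
  have "linear (log_norm_form I X p)" for p
  proof (rule linearI)
    fix v w and r :: real
    show "log_norm_form I X p (v + w) = log_norm_form I X p v + log_norm_form I X p w"
      by (simp add: log_norm_form_def h_add add_divide_distrib)
    have "of_real r * a / b = r *\<^sub>R (a / b)" for a b :: complex by (simp add: scaleR_conv_of_real)
    then show "log_norm_form I X p (r *\<^sub>R v) = r *\<^sub>R log_norm_form I X p v"
      by (simp add: log_norm_form_def h_scale)
  qed
  moreover have "smooth (\<lambda>p. log_norm_form I X p v)" for v
    unfolding log_norm_form_def divide_inverse
    by (intro smooth_mult smooth_const smooth_bounded_linear[OF bounded_linear_Im] smooth_inverse nz
        smooth_hdot smooth_directional X)
  ultimately show ?thesis by (simp add: smooth_form1_def)
qed

text \<open>The second derivatives of \<open>X\<close> cancel by symmetry; what remains is a Hermitian form in the first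
derivatives minus its conjugate. By the formula for \<open>fubini_study\<close> this is the pullback of the
Fubini--Study form along \<open>X\<close>.\<close>

lemma ext_d1_log_norm_form:
  assumes X: "\<And>i. i \<in> I \<Longrightarrow> smooth (X i)" and nz: "\<And>p. hdot I (\<lambda>i. X i p) (\<lambda>i. X i p) \<noteq> 0"
  shows "ext_d1 (log_norm_form I X) p u v =
    - Im (fs_herm I (\<lambda>i. X i p) (\<lambda>i. frechet_derivative (X i) (at p) u)
      (\<lambda>i. frechet_derivative (X i) (at p) v)) / pi"
proof -
  let ?D = "\<lambda>v i. frechet_derivative (X i) (at p) v"
  let ?X = "\<lambda>i. X i p"
  let ?DD = "\<lambda>u v i. frechet_derivative (\<lambda>p. frechet_derivative (X i) (at p) v) (at p) u"
  define N where "N = hdot I ?X ?X"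
  have N: "N \<noteq> 0" "cnj N = N" unfolding N_def by (rule nz, rule cnj_hdot)
  define E where "E = (\<lambda>u v. (hdot I (?DD u v) ?X + hdot I (?D v) (?D u)) / N -
      hdot I (?D v) ?X * (hdot I (?D u) ?X + hdot I ?X (?D u)) / N\<^sup>2)"
  have d: "frechet_derivative (\<lambda>p. log_norm_form I X p v) (at p) u = Im (E u v) / (2 * pi)" for u v
  proof -
    have "((\<lambda>p. hdot I (\<lambda>i. frechet_derivative (X i) (at p) v) (\<lambda>i. X i p) /
        hdot I (\<lambda>i. X i p) (\<lambda>i. X i p)) has_derivative
        (\<lambda>u. - hdot I (?D v) ?X * (inverse N * (hdot I (?D u) ?X + hdot I ?X (?D u)) * inverse N) +
          (hdot I (?DD u v) ?X + hdot I (?D v) (?D u)) / N)) (at p)"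
      unfolding N_def
      by (intro has_derivative_divide frechet_derivative_hdot smooth_directional X nz)
    then have "((\<lambda>p. log_norm_form I X p v) has_derivative (\<lambda>u. Im
        (- hdot I (?D v) ?X * (inverse N * (hdot I (?D u) ?X + hdot I ?X (?D u)) * inverse N) +
          (hdot I (?DD u v) ?X + hdot I (?D v) (?D u)) / N) / (2 * pi))) (at p)"
      unfolding log_norm_form_def
      by (intro bounded_linear.has_derivative[OF bounded_linear_divide] has_derivative_Im)
    moreover have "- a * (inverse N * s * inverse N) + d / N = d / N - a * s / N\<^sup>2" for a s d
      using N(1) by (simp add: field_simps power2_eq_square)
    ultimately have "((\<lambda>p. log_norm_form I X p v) has_derivative (\<lambda>u. Im (E u v) / (2 * pi))) (at p)"
      unfolding E_def by (simp only:)
    from frechet_derivative_eqI[OF this] show ?thesis by simp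
  qed
  have sym: "hdot I (?DD u v) ?X = hdot I (?DD v u) ?X"
    unfolding hdot_def by (intro sum.cong refl) (simp add: smooth_second_derivative_symmetric[OF X])
  let ?P = "\<lambda>u v. fs_herm I ?X (?D u) (?D v)"
  have "E u v - E v u = cnj (?P u v) - ?P u v"
    unfolding E_def cnj_fs_herm sym unfolding fs_herm_def N_def[symmetric]
    by (simp add: add_divide_distrib diff_divide_distrib ring_distribs mult.commute)
  then have "Im (E u v) - Im (E v u) = - 2 * Im (?P u v)"
    by (simp add: complex_eq_iff)
  then show ?thesis
    unfolding ext_d1_def d diff_divide_distrib[symmetric] by simp
qed

lemma log_norm_form_cong:
  assumes "\<And>i. i \<in> I \<Longrightarrow> X i = Y i"
  shows "log_norm_form I X = log_norm_form I Y"
  by (intro ext) (simp add: log_norm_form_def hdot_def assms)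

lemma log_norm_form_pullback1:
  assumes X: "\<And>i. i \<in> I \<Longrightarrow> smooth (X i)" and g: "\<And>p. g differentiable (at p)"
  shows "pullback1 g (log_norm_form I X) = log_norm_form I (\<lambda>i p. X i (g p))"
proof -
  have "frechet_derivative (\<lambda>p. X i (g p)) (at p) = frechet_derivative (X i) (at (g p)) \<circ> frechet_derivative g (at p)"
    if "i \<in> I" for i p
    using frechet_derivative_compose[OF g, of "X i" p] smooth_has_derivative[OF X[OF that]]
    by (auto simp: o_def differentiable_def)
  then show ?thesis
    by (auto simp: fun_eq_iff pullback1_def log_norm_form_def hdot_def intro!: arg_cong2[where f="(/)"] arg_cong[where f=Im] sum.cong)
qed

text \<open>For \<open>c = exp h\<close> the last term is the closed form \<open>d (Im h) / 2\<pi>\<close>; for factors of automorphy it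
measures how far the primitive is from being invariant.\<close>

lemma log_norm_form_scale:
  assumes X: "\<And>i. i \<in> I \<Longrightarrow> smooth (X i)" and nz: "\<And>p. hdot I (\<lambda>i. X i p) (\<lambda>i. X i p) \<noteq> 0"
    and c: "(c has_derivative c') (at p)" "c p \<noteq> 0"
  shows "log_norm_form I (\<lambda>i p. c p * X i p) p v = log_norm_form I X p v + Im (c' v / c p) / (2 * pi)"
proof -
  let ?D = "\<lambda>i. frechet_derivative (X i) (at p) v"
  have "frechet_derivative (\<lambda>p. c p * X i p) (at p) v = c p * ?D i + c' v * X i p" if "i \<in> I" for i
    using frechet_derivative_eqI[OF has_derivative_mult[OF c(1) smooth_has_derivative[OF X[OF that]]]]
    by simp
  then have "hdot I (\<lambda>i. frechet_derivative (\<lambda>p. c p * X i p) (at p) v) y =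
      hdot I (\<lambda>i. c p * ?D i + c' v * X i p) y" for y
    by (simp add: hdot_def)
  then have "hdot I (\<lambda>i. frechet_derivative (\<lambda>p. c p * X i p) (at p) v) (\<lambda>i. c p * X i p) /
      hdot I (\<lambda>i. c p * X i p) (\<lambda>i. c p * X i p) =
      hdot I ?D (\<lambda>i. X i p) / hdot I (\<lambda>i. X i p) (\<lambda>i. X i p) + c' v / c p"
    using nz[of p] c(2) by (simp add: hdot_simps field_simps)
  then show ?thesis by (simp add: log_norm_form_def add_divide_distrib)
qed

lemma hdot_Times:
  "hdot (I \<times> J) (\<lambda>(i, j). a i * b j) (\<lambda>(i, j). a' i * b' j) = hdot I a a' * hdot J b b'"
  by (simp add: hdot_def sum_product sum.cartesian_product case_prod_unfold mult_ac)

text \<open>The coordinates of the Segre embedding satisfy \<open>|X \<otimes> Y|\<^sup>2 = |X|\<^sup>2 |Y|\<^sup>2\<close>, so their logarithms add up.\<close>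

lemma log_norm_form_segre:
  assumes X: "\<And>i. i \<in> I \<Longrightarrow> smooth (X i)" "\<And>p. hdot I (\<lambda>i. X i p) (\<lambda>i. X i p) \<noteq> 0"
    and Y: "\<And>j. j \<in> J \<Longrightarrow> smooth (Y j)" "\<And>p. hdot J (\<lambda>i. Y i p) (\<lambda>i. Y i p) \<noteq> 0"
  shows "log_norm_form (I \<times> J) (\<lambda>(i, j) p. X i p * Y j p) p v =
    log_norm_form I X p v + log_norm_form J Y p v"
proof -
  let ?DX = "\<lambda>i. frechet_derivative (X i) (at p) v" and ?DY = "\<lambda>j. frechet_derivative (Y j) (at p) v"
  let ?X = "\<lambda>i. X i p" and ?Y = "\<lambda>j. Y j p"
  have XY: "(\<lambda>ij. (case ij of (i, j) \<Rightarrow> \<lambda>p. X i p * Y j p) p) = (\<lambda>(i, j). X i p * Y j p)"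
    by auto
  have "frechet_derivative (case ij of (i, j) \<Rightarrow> \<lambda>p. X i p * Y j p) (at p) v =
      (\<lambda>(i, j). X i p * ?DY j) ij + (\<lambda>(i, j). ?DX i * Y j p) ij" if "ij \<in> I \<times> J" for ij
    using that frechet_derivative_eqI[OF has_derivative_mult[OF smooth_has_derivative[OF X(1)] smooth_has_derivative[OF Y(1)]]]
    by auto
  then have "hdot (I \<times> J) (\<lambda>ij. frechet_derivative (case ij of (i, j) \<Rightarrow> \<lambda>p. X i p * Y j p) (at p) v) y =
      hdot (I \<times> J) (\<lambda>ij. (\<lambda>(i, j). X i p * ?DY j) ij + (\<lambda>(i, j). ?DX i * Y j p) ij) y" for y
    unfolding hdot_def by (intro sum.cong refl) auto
  then have "hdot (I \<times> J) (\<lambda>ij. frechet_derivative (case ij of (i, j) \<Rightarrow> \<lambda>p. X i p * Y j p) (at p) v)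
       (\<lambda>(i, j). X i p * Y j p) = hdot I ?X ?X * hdot J ?DY ?Y + hdot I ?DX ?X * hdot J ?Y ?Y"
    by (simp add: hdot_add_left hdot_Times)
  then have "hdot (I \<times> J) (\<lambda>ij. frechet_derivative (case ij of (i, j) \<Rightarrow> \<lambda>p. X i p * Y j p) (at p) v)
       (\<lambda>(i, j). X i p * Y j p) / hdot (I \<times> J) (\<lambda>(i, j). X i p * Y j p) (\<lambda>(i, j). X i p * Y j p) =
       hdot I ?DX ?X / hdot I ?X ?X + hdot J ?DY ?Y / hdot J ?Y ?Y"
    using X(2)[of p] Y(2)[of p] by (simp add: hdot_Times field_simps)
  then show ?thesis unfolding log_norm_form_def XY by (simp add: add_divide_distrib)
qed

lemma log_norm_form_reindex:
  assumes "bij_betw e I J"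
  shows "log_norm_form I (\<lambda>i. X (e i)) = log_norm_form J X"
proof -
  have *: "hdot I (\<lambda>i. a (e i)) (\<lambda>i. b (e i)) = hdot J a b" for a b
    unfolding hdot_def by (rule sum.reindex_bij_betw[OF assms])
  show ?thesis
    unfolding log_norm_form_def fun_eq_iff
    using *[of "\<lambda>i. frechet_derivative (X i) (at p) v" "\<lambda>i. X i p" for p v]
      *[of "\<lambda>i. X i p" "\<lambda>i. X i p" for p] by simp
qed

section \<open>The form induced by the theta map\<close>

definition fibre_theta :: "(nat \<Rightarrow> complex \<Rightarrow> complex \<Rightarrow> complex) \<Rightarrow> nat \<Rightarrow> real^4 \<Rightarrow> complex" where
  "fibre_theta \<theta> i p = \<theta> i (of_real (p$3) + \<i> * of_real (p$1)) (of_real (p$2) + \<i>)"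

definition base_theta :: "(nat \<Rightarrow> complex \<Rightarrow> complex \<Rightarrow> complex) \<Rightarrow> nat \<Rightarrow> real^4 \<Rightarrow> complex" where
  "base_theta \<theta> j p = \<theta> j (of_real (p$2) + \<i> * of_real (p$4)) \<i>"

lemma theta_coords_nth:
  "theta_coords \<theta> e p $ m = fibre_theta \<theta> (fst (e m)) p * base_theta \<theta> (snd (e m)) p"
  by (simp add: theta_coords_def fibre_theta_def base_theta_def)

lemma theta_family_separately:
  assumes "theta_family k \<theta>" "i \<in> {1..k}"
  shows "holomorphic_separately (\<theta> i) UNIV {\<tau>. Im \<tau> > 0}"
  using assms by (intro holomorphic2_imp_separately) (simp add: theta_family_def)

lemma open_upper_half_plane: "open {\<tau>. Im \<tau> > 0}"
  by (rule open_halfspace_Im_gt)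

lemma fibre_argument_has_derivative:
  "((\<lambda>p::real^4. of_real (p$a) + \<i> * of_real (p$b)) has_derivative
    (\<lambda>v. of_real (v$a) + \<i> * of_real (v$b))) (at p)"
  "((\<lambda>p::real^4. of_real (p$a) + \<i>) has_derivative (\<lambda>v. of_real (v$a))) (at p)"
  by (auto intro!: derivative_eq_intros bounded_linear.has_derivative[OF bounded_linear_vec_nth])

lemma fibre_theta_has_derivative:
  assumes "theta_family k \<theta>" "i \<in> {1..k}"
  shows "(fibre_theta \<theta> i has_derivative
     (\<lambda>v. deriv (\<lambda>w. \<theta> i w (of_real (p$2) + \<i>)) (of_real (p$3) + \<i> * of_real (p$1)) *
            (of_real (v$3) + \<i> * of_real (v$1)) +
          deriv (\<theta> i (of_real (p$3) + \<i> * of_real (p$1))) (of_real (p$2) + \<i>) * of_real (v$2))) (at p)"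
  unfolding fibre_theta_def
  by (rule holomorphic_separately_compose_has_derivative[OF theta_family_separately[OF assms]
        open_UNIV open_upper_half_plane fibre_argument_has_derivative]) auto

lemma base_theta_has_derivative:
  assumes "theta_family k \<theta>" "j \<in> {1..k}"
  shows "(base_theta \<theta> j has_derivative
     (\<lambda>v. deriv (\<lambda>w. \<theta> j w \<i>) (of_real (p$2) + \<i> * of_real (p$4)) *
            (of_real (v$2) + \<i> * of_real (v$4)))) (at p)"
  using holomorphic_separately_compose_has_derivative[OF theta_family_separately[OF assms]
        open_UNIV open_upper_half_plane fibre_argument_has_derivative(1)[of 2 4 p] has_derivative_const[of \<i>]]
  by (simp add: base_theta_def[abs_def])

lemma smooth_fibre_theta:
  assumes "theta_family k \<theta>" "i \<in> {1..k}"
  shows "smooth (fibre_theta \<theta> i)"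
  unfolding fibre_theta_def
  by (rule holomorphic_separately_smooth[OF open_UNIV open_upper_half_plane
        fibre_argument_has_derivative _ _ theta_family_separately[OF assms]]) auto

lemma smooth_base_theta:
  assumes "theta_family k \<theta>" "j \<in> {1..k}"
  shows "smooth (base_theta \<theta> j)"
  unfolding base_theta_def
  by (rule holomorphic_separately_smooth[OF open_UNIV open_upper_half_plane
        fibre_argument_has_derivative(1) has_derivative_const _ _ theta_family_separately[OF assms]]) auto

lemma fibre_theta_nonzero:
  assumes "theta_family k \<theta>" "k \<ge> 2"
  shows "\<exists>i\<in>{1..k}. fibre_theta \<theta> i p \<noteq> 0"
  unfolding fibre_theta_def by (rule theta_family_base_point_free[OF assms]) simp

lemma base_theta_nonzero:
  assumes "theta_family k \<theta>" "k \<ge> 2"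
  shows "\<exists>j\<in>{1..k}. base_theta \<theta> j p \<noteq> 0"
  unfolding base_theta_def by (rule theta_family_base_point_free[OF assms]) simp

lemma hdot_fibre_theta_nonzero:
  assumes "theta_family k \<theta>" "k \<ge> 2"
  shows "hdot {1..k} (\<lambda>i. fibre_theta \<theta> i p) (\<lambda>i. fibre_theta \<theta> i p) \<noteq> 0"
proof -
  obtain i where i: "i \<in> {1..k}" "fibre_theta \<theta> i p \<noteq> 0"
    using fibre_theta_nonzero[OF assms] by blast
  show ?thesis
    by (rule hdot_self_nonzero(2)[where a = "\<lambda>i. fibre_theta \<theta> i p", OF finite_atLeastAtMost i])
qed

lemma hdot_base_theta_nonzero:
  assumes "theta_family k \<theta>" "k \<ge> 2"
  shows "hdot {1..k} (\<lambda>i. base_theta \<theta> i p) (\<lambda>i. base_theta \<theta> i p) \<noteq> 0"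
proof -
  obtain i where i: "i \<in> {1..k}" "base_theta \<theta> i p \<noteq> 0"
    using base_theta_nonzero[OF assms] by blast
  show ?thesis
    by (rule hdot_self_nonzero(2)[where a = "\<lambda>i. base_theta \<theta> i p", OF finite_atLeastAtMost i])
qed

lemma theta_coords_index:
  assumes "bij_betw e (UNIV :: 'n set) ({1..k} \<times> {1..k})"
  shows "fst (e m) \<in> {1..k}" "snd (e m) \<in> {1..k}"
  using bij_betwE[OF assms, rule_format, of m] by (auto simp: mem_Times_iff)

lemma smooth_theta_coords_nth:
  assumes "theta_family k \<theta>" "bij_betw e (UNIV :: 'n::finite set) ({1..k} \<times> {1..k})"
  shows "smooth (\<lambda>p. theta_coords \<theta> e p $ m)"
  unfolding theta_coords_nth
  by (intro smooth_mult smooth_fibre_theta[OF assms(1)] smooth_base_theta[OF assms(1)]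
      theta_coords_index[OF assms(2)])

lemma theta_coords_nonzero:
  assumes th: "theta_family k \<theta>" and k: "k \<ge> 2" and e: "bij_betw e (UNIV :: 'n::finite set) ({1..k} \<times> {1..k})"
  shows "theta_coords \<theta> e p \<noteq> 0"
proof -
  obtain i j where ij: "i \<in> {1..k}" "fibre_theta \<theta> i p \<noteq> 0" "j \<in> {1..k}" "base_theta \<theta> j p \<noteq> 0"
    using fibre_theta_nonzero[OF th k] base_theta_nonzero[OF th k] by blast
  then have "(i, j) \<in> range e" using e by (auto simp: bij_betw_def)
  then obtain m where "e m = (i, j)" by (metis imageE)
  then have "theta_coords \<theta> e p $ m \<noteq> 0" using ij by (simp add: theta_coords_nth)
  then show ?thesis by auto
qed

lemma theta_values_quasi_periodic:
  assumes th: "theta_family k \<theta>" and i: "i \<in> {1..k}" and t: "Im \<tau> > 0"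
  shows "\<theta> i (w + 1) \<tau> = \<theta> i w \<tau>"
    and "\<theta> i (w + \<tau>) \<tau> = exp (- 2 * of_real pi * \<i> * of_nat k * w) * \<theta> i w \<tau>"
    and "\<theta> i w (\<tau> + 1) = \<theta> i w \<tau>"
proof -
  have "(\<lambda>w. \<theta> i w \<tau>) \<in> theta_space k \<tau>"
    by (rule theta_family_in_theta_space[OF th i t])
  then show "\<theta> i (w + 1) \<tau> = \<theta> i w \<tau>"
    "\<theta> i (w + \<tau>) \<tau> = exp (- 2 * of_real pi * \<i> * of_nat k * w) * \<theta> i w \<tau>"
    by (simp_all add: theta_space_def)
  show "\<theta> i w (\<tau> + 1) = \<theta> i w \<tau>"
    using th i t by (simp add: theta_family_def)
qed

lemma fibre_theta_transform:
  assumes "theta_family k \<theta>" "i \<in> {1..k}"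
  shows "fibre_theta \<theta> i (kt_a p) =
      exp (- 2 * of_real pi * \<i> * of_nat k * (of_real (p$3) + \<i> * of_real (p$1))) * fibre_theta \<theta> i p"
    and "fibre_theta \<theta> i (kt_b p) = fibre_theta \<theta> i p"
    and "fibre_theta \<theta> i (kt_c p) = fibre_theta \<theta> i p"
    and "fibre_theta \<theta> i (kt_d p) = fibre_theta \<theta> i p"
proof -
  let ?w = "of_real (p$3) + \<i> * of_real (p$1)" and ?\<tau> = "of_real (p$2) + \<i>"
  have t: "Im ?\<tau> > 0" by simp
  have arg: "of_real (p$3 + p$2) + \<i> * of_real (p$1 + 1) = ?w + ?\<tau>"
    "of_real (p$2 + 1) + \<i> = ?\<tau> + 1" "of_real (p$3 + 1) + \<i> * of_real (p$1) = ?w + 1"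
    by (simp_all add: algebra_simps)
  show "fibre_theta \<theta> i (kt_a p) = exp (- 2 * of_real pi * \<i> * of_nat k * ?w) * fibre_theta \<theta> i p"
    "fibre_theta \<theta> i (kt_b p) = fibre_theta \<theta> i p"
    "fibre_theta \<theta> i (kt_c p) = fibre_theta \<theta> i p"
    "fibre_theta \<theta> i (kt_d p) = fibre_theta \<theta> i p"
    unfolding fibre_theta_def kt_component arg theta_values_quasi_periodic[OF assms t] by (rule refl)+
qed

lemma base_theta_transform:
  assumes "theta_family k \<theta>" "j \<in> {1..k}"
  shows "base_theta \<theta> j (kt_a p) = base_theta \<theta> j p"
    and "base_theta \<theta> j (kt_b p) = base_theta \<theta> j p"
    and "base_theta \<theta> j (kt_c p) = base_theta \<theta> j p"
    and "base_theta \<theta> j (kt_d p) =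
      exp (- 2 * of_real pi * \<i> * of_nat k * (of_real (p$2) + \<i> * of_real (p$4))) * base_theta \<theta> j p"
proof -
  let ?w = "of_real (p$2) + \<i> * of_real (p$4)"
  have t: "Im \<i> > 0" by simp
  have arg: "of_real (p$2) + \<i> * of_real (p$4 + 1) = ?w + \<i>"
    "of_real (p$2 + 1) + \<i> * of_real (p$4) = ?w + 1"
    by (simp_all add: algebra_simps)
  show "base_theta \<theta> j (kt_a p) = base_theta \<theta> j p"
    "base_theta \<theta> j (kt_b p) = base_theta \<theta> j p"
    "base_theta \<theta> j (kt_c p) = base_theta \<theta> j p"
    "base_theta \<theta> j (kt_d p) = exp (- 2 * of_real pi * \<i> * of_nat k * ?w) * base_theta \<theta> j p"
    unfolding base_theta_def kt_component arg theta_values_quasi_periodic[OF assms t] by (rule refl)+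
qed

text \<open>The logarithmic derivative of the factor is \<open>- 2\<pi>ik (dp\<^sub>a + i dp\<^sub>b)\<close>, and its imaginary part divided
by \<open>2\<pi>\<close> is \<open>- k dp\<^sub>a\<close>.\<close>

lemma log_norm_form_exp_factor:
  fixes X :: "'i \<Rightarrow> real^4 \<Rightarrow> complex"
  assumes X: "\<And>i. i \<in> I \<Longrightarrow> smooth (X i)" and nz: "\<And>p. hdot I (\<lambda>i. X i p) (\<lambda>i. X i p) \<noteq> 0"
    and g: "\<And>p. g differentiable (at p)"
    and Xg: "\<And>i p. i \<in> I \<Longrightarrow> X i (g p) =
      exp (- 2 * of_real pi * \<i> * of_nat k * (of_real (p$a) + \<i> * of_real (p$b))) * X i p"
  shows "pullback1 g (log_norm_form I X) = (\<lambda>p v. log_norm_form I X p v - real k * v$a)"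
proof (intro ext)
  fix p v
  let ?c = "\<lambda>p::real^4. exp (- 2 * of_real pi * \<i> * of_nat k * (of_real (p$a) + \<i> * of_real (p$b)))"
  have "(?c has_derivative (\<lambda>v. ?c p * (- 2 * of_real pi * \<i> * of_nat k * (of_real (v$a) + \<i> * of_real (v$b))))) (at p)"
    by (rule has_derivative_compose[OF has_derivative_mult_right[OF fibre_argument_has_derivative(1)]
        DERIV_exp[unfolded has_field_derivative_def]])
  from log_norm_form_scale[OF X nz this, of v] have
    "log_norm_form I (\<lambda>i p. ?c p * X i p) p v = log_norm_form I X p v - real k * v$a" by simp
  moreover have "log_norm_form I (\<lambda>i p. X i (g p)) = log_norm_form I (\<lambda>i p. ?c p * X i p)"
    by (rule log_norm_form_cong) (simp add: Xg)
  ultimately show "pullback1 g (log_norm_form I X) p v = log_norm_form I X p v - real k * v$a"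
    by (simp only: log_norm_form_pullback1[OF X g])
qed

lemma log_norm_form_pullback1_invariant:
  assumes X: "\<And>i. i \<in> I \<Longrightarrow> smooth (X i)" and g: "\<And>p. g differentiable (at p)"
    and Xg: "\<And>i p. i \<in> I \<Longrightarrow> X i (g p) = X i p"
  shows "pullback1 g (log_norm_form I X) = log_norm_form I X"
proof -
  have "log_norm_form I (\<lambda>i p. X i (g p)) = log_norm_form I X"
    by (rule log_norm_form_cong) (simp add: Xg)
  then show ?thesis by (simp only: log_norm_form_pullback1[OF X g])
qed

text \<open>The first two terms are a primitive of the induced form on \<open>\<real>\<^sup>4\<close>, the last one is a primitive of
\<open>- k \<omega>\<close>. None of the terms is invariant under the group, but their sum is.\<close>

definition theta_primitive :: "nat \<Rightarrow> (nat \<Rightarrow> complex \<Rightarrow> complex \<Rightarrow> complex) \<Rightarrow> (real^4) form1" where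
  "theta_primitive k \<theta> p v = log_norm_form {1..k} (fibre_theta \<theta>) p v +
     log_norm_form {1..k} (base_theta \<theta>) p v + KT_correction (real k) p v"

text \<open>The coefficient \<open>l (l - 1) / 2\<close> vanishes for the generators, where \<open>l\<close> is \<open>0\<close> or \<open>1\<close>: this is the
effect of the term \<open>- dz/2\<close>.\<close>

lemma KT_correction_pullback1:
  "pullback1 (kt_map l m n r) (KT_correction c) p v = KT_correction c p v +
     c * (l * v$3 + l * (l - 1) / 2 * v$2 + r * v$2)"
  by (simp add: pullback1_def frechet_derivative_eqI[OF kt_map_has_derivative] KT_correction_def
      axis_def field_simps power2_eq_square)

lemma theta_primitive_invariant:
  assumes th: "theta_family k \<theta>" and k: "k \<ge> 2" and h: "h \<in> {kt_a, kt_b, kt_c, kt_d}"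
  shows "pullback1 h (theta_primitive k \<theta>) = theta_primitive k \<theta>"
proof -
  let ?F = "log_norm_form {1..k} (fibre_theta \<theta>)" and ?B = "log_norm_form {1..k} (base_theta \<theta>)"
  have split: "pullback1 h (theta_primitive k \<theta>) p v =
      pullback1 h ?F p v + pullback1 h ?B p v + pullback1 h (KT_correction (real k)) p v" for h p v
    by (simp add: pullback1_def theta_primitive_def)
  note sF = smooth_fibre_theta[OF th] and sB = smooth_base_theta[OF th]
    and nF = hdot_fibre_theta_nonzero[OF th k] and nB = hdot_base_theta_nonzero[OF th k]
    and tF = fibre_theta_transform[OF th] and tB = base_theta_transform[OF th]
  note d = kt_generator_differentiable
  have F: "pullback1 kt_a ?F = (\<lambda>p v. ?F p v - real k * v$3)"
    "pullback1 kt_b ?F = ?F" "pullback1 kt_c ?F = ?F" "pullback1 kt_d ?F = ?F"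
    by (rule log_norm_form_exp_factor[OF sF nF d tF(1)] log_norm_form_pullback1_invariant[OF sF d tF(2)]
        log_norm_form_pullback1_invariant[OF sF d tF(3)] log_norm_form_pullback1_invariant[OF sF d tF(4)];
        blast)+
  have B: "pullback1 kt_a ?B = ?B" "pullback1 kt_b ?B = ?B" "pullback1 kt_c ?B = ?B"
    "pullback1 kt_d ?B = (\<lambda>p v. ?B p v - real k * v$2)"
    by (rule log_norm_form_pullback1_invariant[OF sB d tB(1)] log_norm_form_pullback1_invariant[OF sB d tB(2)]
        log_norm_form_pullback1_invariant[OF sB d tB(3)] log_norm_form_exp_factor[OF sB nB d tB(4)];
        blast)+
  have C: "pullback1 kt_a (KT_correction (real k)) p v = KT_correction (real k) p v + real k * v$3"
    "pullback1 kt_b (KT_correction (real k)) p v = KT_correction (real k) p v"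
    "pullback1 kt_c (KT_correction (real k)) p v = KT_correction (real k) p v"
    "pullback1 kt_d (KT_correction (real k)) p v = KT_correction (real k) p v + real k * v$2" for p v
    by (simp_all add: kt_generators_eq_kt_map KT_correction_pullback1)
  show ?thesis
  proof (intro ext)
    fix p v
    from h show "pullback1 h (theta_primitive k \<theta>) p v = theta_primitive k \<theta> p v"
      by (elim insertE emptyE) (simp_all add: split F B C theta_primitive_def del: One_nat_def)
  qed
qed

lemma KT_form1_theta_primitive:
  assumes th: "theta_family k \<theta>" and k: "k \<ge> 2"
  shows "KT_form1 (theta_primitive k \<theta>)"
proof -
  have "smooth_form1 (theta_primitive k \<theta>)"
    unfolding theta_primitive_def[abs_def]
    by (intro smooth_form1_add smooth_form1_log_norm_form smooth_form1_KT_correction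
        smooth_fibre_theta[OF th] smooth_base_theta[OF th] hdot_fibre_theta_nonzero[OF th k]
        hdot_base_theta_nonzero[OF th k])
  then show ?thesis
    unfolding KT_form1_def
    using pullback1_KT_group_invariant theta_primitive_invariant[OF th k] by blast
qed

lemma has_derivative_vecI:
  fixes f :: "'a::real_normed_vector \<Rightarrow> ('b::euclidean_space)^'n"
  assumes "\<And>m. ((\<lambda>x. f x $ m) has_derivative (\<lambda>v. f' v $ m)) (at p)"
  shows "(f has_derivative f') (at p)"
  unfolding has_derivative_componentwise_within[of f]
  using assms has_derivative_inner_left by (force simp: Basis_vec_def inner_axis)

lemma cline_eq: "cline Z = range (\<lambda>c. c *s Z)"
  unfolding cline_def by (rule vec.span_singleton)

lemma cp_chart_cline:
  fixes Z :: "complex^'n"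
  assumes "Z $ j \<noteq> 0"
  shows "cp_chart j (cline Z) = inverse (Z $ j) *s Z"
  unfolding cp_chart_def cline_eq
proof (rule the_equality)
  show "inverse (Z $ j) *s Z \<in> range (\<lambda>c. c *s Z) \<and> (inverse (Z $ j) *s Z) $ j = 1"
    using assms by (intro conjI rangeI) simp
  fix W assume "W \<in> range (\<lambda>c. c *s Z) \<and> W $ j = 1"
  then obtain c where W: "W = c *s Z" and "W $ j = 1" by blast
  then have "c * Z $ j = 1" by simp
  then have "c = inverse (Z $ j)" using assms by (simp add: field_simps)
  then show "W = inverse (Z $ j) *s Z" by (simp add: W)
qed

lemma theta_chart_has_derivative:
  assumes th: "theta_family k \<theta>" and e: "bij_betw e (UNIV :: 'n::finite set) ({1..k} \<times> {1..k})"
    and j: "theta_coords \<theta> e p $ j \<noteq> 0"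
  obtains c' where "((\<lambda>q. cp_chart j (theta_map \<theta> e (KT_proj q))) has_derivative
     (\<lambda>v. \<chi> m. c' v * theta_coords \<theta> e p $ m +
        inverse (theta_coords \<theta> e p $ j) * frechet_derivative (\<lambda>q. theta_coords \<theta> e q $ m) (at p) v)) (at p)"
proof -
  let ?T = "\<lambda>m q. theta_coords \<theta> e q $ m"
  note s = smooth_theta_coords_nth[OF th e]
  define c' where "c' = frechet_derivative (\<lambda>q. inverse (?T j q)) (at p)"
  have dj: "((\<lambda>q. inverse (?T j q)) has_derivative c') (at p)"
    unfolding c'_def frechet_derivative_works[symmetric]
    using Deriv.has_derivative_inverse[OF j smooth_has_derivative[OF s]] by (auto simp: differentiable_def)
  have "((\<lambda>q. inverse (?T j q) *s theta_coords \<theta> e q) has_derivative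
     (\<lambda>v. \<chi> m. c' v * ?T m p + inverse (?T j p) * frechet_derivative (?T m) (at p) v)) (at p)"
    by (rule has_derivative_vecI)
       (use has_derivative_mult[OF dj smooth_has_derivative[OF s]] in \<open>simp add: add.commute\<close>)
  moreover have "open {q. ?T j q \<noteq> 0}"
    using s[of j] unfolding smooth_def by (intro open_Collect_neq) (auto dest: spec[of _ 0])
  ultimately have "((\<lambda>q. cp_chart j (theta_map \<theta> e (KT_proj q))) has_derivative
     (\<lambda>v. \<chi> m. c' v * ?T m p + inverse (?T j p) * frechet_derivative (?T m) (at p) v)) (at p)"
    by (rule has_derivative_transform_within_open)
       (use j in \<open>auto simp: theta_map_KT_proj[OF th e] cp_chart_cline\<close>)
  then show ?thesis by (rule that)
qed

lemma theta_chart_index: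
  assumes th: "theta_family k \<theta>" and k: "k \<ge> 2" and e: "bij_betw e (UNIV :: 'n::finite set) ({1..k} \<times> {1..k})"
  shows "theta_coords \<theta> e p $ (SOME j. \<exists>Z\<in>theta_map \<theta> e (KT_proj p). Z $ j \<noteq> 0) \<noteq> 0"
proof -
  have line: "(\<exists>Z\<in>theta_map \<theta> e (KT_proj p). Z $ j \<noteq> 0) \<longleftrightarrow> theta_coords \<theta> e p $ j \<noteq> 0" for j
    unfolding theta_map_KT_proj[OF th e] cline_eq by (auto intro: exI[of _ 1])
  have "\<exists>j. theta_coords \<theta> e p $ j \<noteq> 0"
    using theta_coords_nonzero[OF th k e, of p] by (auto simp: vec_eq_iff)
  then show ?thesis unfolding line by (rule someI_ex)
qed

text \<open>In the affine chart the map is given by the homogeneous coordinates divided by one of them. This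
factor does not affect the Hermitian form, so the form can be computed with the theta functions
themselves.\<close>

lemma KT_pullback_theta_map:
  assumes th: "theta_family k \<theta>" and k: "k \<ge> 2" and e: "bij_betw e (UNIV :: 'n::finite set) ({1..k} \<times> {1..k})"
  shows "KT_pullback (theta_map \<theta> e) fubini_study =
    ext_d1 (log_norm_form UNIV (\<lambda>m p. theta_coords \<theta> e p $ m))"
proof (intro ext)
  fix p u v
  let ?T = "\<lambda>m q. theta_coords \<theta> e q $ m"
  define j where "j = (SOME j. \<exists>Z\<in>theta_map \<theta> e (KT_proj p). Z $ j \<noteq> 0)"
  have j: "?T j p \<noteq> 0" unfolding j_def by (rule theta_chart_index[OF th k e])
  define c where "c = inverse (?T j p)"
  obtain c' where d: "((\<lambda>q. cp_chart j (theta_map \<theta> e (KT_proj q))) has_derivative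
     (\<lambda>v. \<chi> m. c' v * ?T m p + c * frechet_derivative (?T m) (at p) v)) (at p)"
    using theta_chart_has_derivative[OF th e j] unfolding c_def by blast
  have chart: "cp_chart j (theta_map \<theta> e (KT_proj p)) = c *s theta_coords \<theta> e p"
    unfolding theta_map_KT_proj[OF th e] cp_chart_cline[OF j] c_def ..
  have c: "c \<noteq> 0" using j by (simp add: c_def)
  have nz: "hdot UNIV (\<lambda>m. ?T m q) (\<lambda>m. ?T m q) \<noteq> 0" for q
    using theta_coords_nonzero[OF th k e, of q] hdot_self_nonzero(2)[OF finite UNIV_I]
    by (auto simp: vec_eq_iff)
  have nth: "($) (\<chi> m. f m) = f" "($) (a *s Z) = (\<lambda>m. a * Z $ m)"
    for f :: "'n \<Rightarrow> complex" and a and Z :: "complex^'n"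
    by (simp_all add: fun_eq_iff)
  have "KT_pullback (theta_map \<theta> e) fubini_study p u v =
      fubini_study (c *s theta_coords \<theta> e p) (\<chi> m. c' u * ?T m p + c * frechet_derivative (?T m) (at p) u)
        (\<chi> m. c' v * ?T m p + c * frechet_derivative (?T m) (at p) v)"
    unfolding KT_pullback_def j_def[symmetric] Let_def pullback2_def frechet_derivative_eqI[OF d] chart ..
  also have "\<dots> = - Im (fs_herm UNIV (\<lambda>m. c * ?T m p) (\<lambda>m. c' u * ?T m p + c * frechet_derivative (?T m) (at p) u)
      (\<lambda>m. c' v * ?T m p + c * frechet_derivative (?T m) (at p) v)) / pi"
    using c theta_coords_nonzero[OF th k e, of p]
    by (subst fubini_study_eq_fs_herm) (simp_all add: vec.scale_eq_0_iff nth)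
  also have "\<dots> = ext_d1 (log_norm_form UNIV ?T) p u v"
    unfolding fs_herm_homogeneous[OF c nz]
    by (rule ext_d1_log_norm_form[OF smooth_theta_coords_nth[OF th e] nz, symmetric])
  finally show "KT_pullback (theta_map \<theta> e) fubini_study p u v = ext_d1 (log_norm_form UNIV ?T) p u v" .
qed

lemma log_norm_form_theta_coords:
  assumes th: "theta_family k \<theta>" and k: "k \<ge> 2" and e: "bij_betw e (UNIV :: 'n::finite set) ({1..k} \<times> {1..k})"
  shows "log_norm_form UNIV (\<lambda>m p. theta_coords \<theta> e p $ m) =
    (\<lambda>p v. log_norm_form {1..k} (fibre_theta \<theta>) p v + log_norm_form {1..k} (base_theta \<theta>) p v)"
proof -
  let ?X = "\<lambda>(i, j) p. fibre_theta \<theta> i p * base_theta \<theta> j p"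
  have "log_norm_form UNIV (\<lambda>m p. theta_coords \<theta> e p $ m) = log_norm_form UNIV (\<lambda>m. ?X (e m))"
    by (simp add: theta_coords_nth case_prod_unfold)
  also have "\<dots> = log_norm_form ({1..k} \<times> {1..k}) ?X"
    by (rule log_norm_form_reindex[OF e])
  finally have eq: "log_norm_form UNIV (\<lambda>m p. theta_coords \<theta> e p $ m) =
    log_norm_form ({1..k} \<times> {1..k}) ?X" .
  show ?thesis
    unfolding eq by (intro ext log_norm_form_segre smooth_fibre_theta[OF th] hdot_fibre_theta_nonzero[OF th k]
        smooth_base_theta[OF th] hdot_base_theta_nonzero[OF th k])
qed

text \<open>The chart expression of the map at \<open>p\<close> is invariant under the group, because it only depends on the
orbit; the chain rule then gives the invariance of anything pulled back along it.\<close>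

lemma KT_pullback_theta_map_invariant:
  assumes th: "theta_family k \<theta>" and k: "k \<ge> 2" and e: "bij_betw e (UNIV :: 'n::finite set) ({1..k} \<times> {1..k})"
    and g: "g \<in> KT_group"
  shows "pullback2 g (KT_pullback (theta_map \<theta> e) \<Omega>) = KT_pullback (theta_map \<theta> e) \<Omega>"
proof (intro ext)
  fix p u v
  define j where "j = (SOME j. \<exists>Z\<in>theta_map \<theta> e (KT_proj p). Z $ j \<noteq> 0)"
  let ?f = "\<lambda>q. cp_chart j (theta_map \<theta> e (KT_proj q))"
  have "theta_coords \<theta> e (g p) $ j \<noteq> 0"
    using theta_chart_index[OF th k e, of "g p"] unfolding KT_proj_invariant[OF g] j_def .
  then have "?f differentiable (at (g p))"
    by (rule theta_chart_has_derivative[OF th e]) (rule differentiableI)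
  from frechet_derivative_compose[OF KT_group_differentiable[OF g] this]
  have "frechet_derivative ?f (at p) = frechet_derivative ?f (at (g p)) \<circ> frechet_derivative g (at p)"
    by (simp add: o_def KT_proj_invariant[OF g])
  then show "pullback2 g (KT_pullback (theta_map \<theta> e) \<Omega>) p u v = KT_pullback (theta_map \<theta> e) \<Omega> p u v"
    unfolding KT_pullback_def pullback2_def KT_proj_invariant[OF g] Let_def j_def[symmetric] by simp
qed

text \<open>In a direction \<open>v\<close> the derivative of \<open>B\<close> is \<open>(v\<^sub>2 + i v\<^sub>4) \<partial>B/\<partial>w\<close>, and the derivative of \<open>A\<close> is
\<open>(v\<^sub>3 + i v\<^sub>1) \<partial>A/\<partial>w + v\<^sub>2 \<partial>A/\<partial>\<tau>\<close>. In each of the three cases the test vector \<open>v\<close> is such that only one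
of the two parts of the form contributes and \<open>\<partial>A/\<partial>\<tau>\<close>, about which nothing is known, does not
occur.\<close>

lemma theta_form_nondegenerate:
  assumes th: "theta_family k \<theta>" and k: "k \<ge> 3" and u: "u \<noteq> 0"
  shows "\<exists>v. ext_d1 (log_norm_form {1..k} (fibre_theta \<theta>)) p u v +
    ext_d1 (log_norm_form {1..k} (base_theta \<theta>)) p u v \<noteq> 0"
proof -
  have k2: "k \<ge> 2" using k by simp
  define A where "A = (\<lambda>i. fibre_theta \<theta> i p)"
  define B where "B = (\<lambda>i. base_theta \<theta> i p)"
  define Aw where "Aw = (\<lambda>i. deriv (\<lambda>w. \<theta> i w (of_real (p$2) + \<i>)) (of_real (p$3) + \<i> * of_real (p$1)))"
  define At where "At = (\<lambda>i. deriv (\<theta> i (of_real (p$3) + \<i> * of_real (p$1))) (of_real (p$2) + \<i>))"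
  define Bw where "Bw = (\<lambda>i. deriv (\<lambda>w. \<theta> i w \<i>) (of_real (p$2) + \<i> * of_real (p$4)))"
  define dA where "dA = (\<lambda>v::real^4. \<lambda>i. Aw i * (of_real (v$3) + \<i> * of_real (v$1)) + At i * of_real (v$2))"
  define dB where "dB = (\<lambda>v::real^4. \<lambda>i. Bw i * (of_real (v$2) + \<i> * of_real (v$4)))"
  let ?F = "\<lambda>v. ext_d1 (log_norm_form {1..k} (fibre_theta \<theta>)) p u v +
    ext_d1 (log_norm_form {1..k} (base_theta \<theta>)) p u v"
  have fs: "fs_herm {1..k} x (\<lambda>i. frechet_derivative (X i) (at p) u) (\<lambda>i. frechet_derivative (X i) (at p) v) =
      fs_herm {1..k} x (D u) (D v)"
    if "\<And>i w. i \<in> {1..k} \<Longrightarrow> frechet_derivative (X i) (at p) w = D w i" for x X D u v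
    using that by (simp add: fs_herm_def hdot_def)
  have F: "?F v = - (Im (fs_herm {1..k} A (dA u) (dA v)) + Im (fs_herm {1..k} B (dB u) (dB v))) / pi" for v
  proof -
    have "fs_herm {1..k} A (\<lambda>i. frechet_derivative (fibre_theta \<theta> i) (at p) u)
        (\<lambda>i. frechet_derivative (fibre_theta \<theta> i) (at p) v) = fs_herm {1..k} A (dA u) (dA v)"
      by (rule fs) (simp add: frechet_derivative_eqI[OF fibre_theta_has_derivative[OF th]] dA_def Aw_def At_def)
    moreover have "fs_herm {1..k} B (\<lambda>i. frechet_derivative (base_theta \<theta> i) (at p) u)
        (\<lambda>i. frechet_derivative (base_theta \<theta> i) (at p) v) = fs_herm {1..k} B (dB u) (dB v)"
      by (rule fs) (simp add: frechet_derivative_eqI[OF base_theta_has_derivative[OF th]] dB_def Bw_def)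
    moreover have "ext_d1 (log_norm_form {1..k} (fibre_theta \<theta>)) p u v =
        - Im (fs_herm {1..k} A (\<lambda>i. frechet_derivative (fibre_theta \<theta> i) (at p) u)
        (\<lambda>i. frechet_derivative (fibre_theta \<theta> i) (at p) v)) / pi"
      unfolding A_def by (rule ext_d1_log_norm_form[OF smooth_fibre_theta[OF th] hdot_fibre_theta_nonzero[OF th k2]])
    moreover have "ext_d1 (log_norm_form {1..k} (base_theta \<theta>)) p u v =
        - Im (fs_herm {1..k} B (\<lambda>i. frechet_derivative (base_theta \<theta> i) (at p) u)
        (\<lambda>i. frechet_derivative (base_theta \<theta> i) (at p) v)) / pi"
      unfolding B_def by (rule ext_d1_log_norm_form[OF smooth_base_theta[OF th] hdot_base_theta_nonzero[OF th k2]])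
    ultimately show ?thesis by (simp only: minus_add_distrib add_divide_distrib)
  qed
  obtain a where a: "a > 0" "fs_herm {1..k} A Aw Aw = of_real a"
  proof -
    obtain i where "i \<in> {1..k}" "A i \<noteq> 0" using fibre_theta_nonzero[OF th k2] A_def by blast
    moreover have "\<not> (\<forall>i\<in>{1..k}. Aw i = c * A i)" for c
      unfolding Aw_def A_def fibre_theta_def by (rule theta_family_immersive[OF th k]) simp
    ultimately show ?thesis using fs_herm_positive[of "{1..k}" i A Aw] that by blast
  qed
  obtain b where b: "b > 0" "fs_herm {1..k} B Bw Bw = of_real b"
  proof -
    obtain i where "i \<in> {1..k}" "B i \<noteq> 0" using base_theta_nonzero[OF th k2] B_def by blast
    moreover have "\<not> (\<forall>i\<in>{1..k}. Bw i = c * B i)" for c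
      unfolding Bw_def B_def base_theta_def by (rule theta_family_immersive[OF th k]) simp
    ultimately show ?thesis using fs_herm_positive[of "{1..k}" i B Bw] that by blast
  qed
  have zero: "fs_herm I x (\<lambda>i. 0) y = 0" "fs_herm I x y (\<lambda>i. 0) = 0" for I :: "nat set" and x y
    by (simp_all add: fs_herm_def hdot_def)
  have scale: "fs_herm {1..k} A (\<lambda>i. Aw i * s) (\<lambda>i. Aw i * t) = s * cnj t * of_real a"
    "fs_herm {1..k} B (\<lambda>i. Bw i * s) (\<lambda>i. Bw i * t) = s * cnj t * of_real b" for s t
    using fs_herm_scale[of "{1..k}" A s Aw t Aw] fs_herm_scale[of "{1..k}" B s Bw t Bw] a b
    by (simp_all add: mult.commute[of _ s] mult.commute[of _ t])
  consider "u$2 \<noteq> 0" | "u$2 = 0" "u$1 \<noteq> 0 \<or> u$3 \<noteq> 0" | "u$2 = 0" "u$1 = 0" "u$3 = 0" "u$4 \<noteq> 0"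
    using u by (auto simp: vec_eq_iff forall_4)
  then show ?thesis
  proof cases
    case 1
    \<comment> \<open>The direction \<open>\<partial>/\<partial>t\<close>, in which \<open>A\<close> is constant.\<close>
    define v :: "real^4" where "v = vector [0, 0, 0, 1]"
    have "dA v = (\<lambda>i. 0)" "dB v = (\<lambda>i. Bw i * \<i>)"
      "dB u = (\<lambda>i. Bw i * (of_real (u$2) + \<i> * of_real (u$4)))" by (simp_all add: dA_def dB_def v_def)
    then have "?F v = u$2 * b / pi"
      unfolding F by (simp only: zero scale) simp
    then have "?F v \<noteq> 0" using 1 b by simp
    then show ?thesis by blast
  next
    case 2
    \<comment> \<open>Here \<open>v\<^sub>3 + i v\<^sub>1 = i (u\<^sub>3 + i u\<^sub>1)\<close>: rotation by the complex structure makes the form positive.\<close>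
    define v :: "real^4" where "v = vector [u$3, 0, - u$1, 0]"
    have "dB v = (\<lambda>i. 0)" "dA v = (\<lambda>i. Aw i * (- of_real (u$1) + \<i> * of_real (u$3)))"
      "dA u = (\<lambda>i. Aw i * (of_real (u$3) + \<i> * of_real (u$1)))"
      using 2 by (simp_all add: dA_def dB_def v_def)
    then have "?F v = ((u$1)\<^sup>2 + (u$3)\<^sup>2) * a / pi"
      unfolding F by (simp only: zero scale) (simp add: algebra_simps power2_eq_square)
    moreover have "(u$1)\<^sup>2 + (u$3)\<^sup>2 \<noteq> 0" using 2 by (simp add: sum_power2_eq_zero_iff)
    ultimately have "?F v \<noteq> 0" using a by simp
    then show ?thesis by blast
  next
    case 3
    \<comment> \<open>Now \<open>u\<close> is a multiple of \<open>\<partial>/\<partial>t\<close>, so \<open>A\<close> is constant along \<open>u\<close> and \<open>v\<close> may be any vector with \<open>v\<^sub>2 \<noteq> 0\<close>.\<close>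
    define v :: "real^4" where "v = vector [0, 1, 0, 0]"
    have "dA u = (\<lambda>i. 0)" "dB v = (\<lambda>i. Bw i * 1)" "dB u = (\<lambda>i. Bw i * (\<i> * of_real (u$4)))"
      using 3 by (simp_all add: dA_def dB_def v_def)
    then have "?F v = - (u$4 * b) / pi"
      unfolding F by (simp only: zero scale) simp
    then have "?F v \<noteq> 0" using 3 b by simp
    then show ?thesis by blast
  qed
qed

theorem theorem2:
  fixes k :: nat
    and \<theta> :: "nat \<Rightarrow> complex \<Rightarrow> complex \<Rightarrow> complex"
    and e :: "'n::finite \<Rightarrow> nat \<times> nat"
  assumes "k \<ge> 3"
    and "theta_family k \<theta>"
    and "bij_betw e UNIV ({1..k} \<times> {1..k})"
  shows "KT_symplectic (KT_pullback (theta_map \<theta> e) fubini_study) \<and>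
         KT_cohomologous (KT_pullback (theta_map \<theta> e) fubini_study)
           (\<lambda>p u v. real k * omega_KT p u v)"
proof -
  note k = assms(1) and th = assms(2) and e = assms(3)
  have k2: "k \<ge> 2" using k by simp
  let ?F = "log_norm_form {1..k} (fibre_theta \<theta>)" and ?B = "log_norm_form {1..k} (base_theta \<theta>)"
  let ?\<alpha> = "KT_pullback (theta_map \<theta> e) fubini_study"
  have F: "smooth_form1 ?F"
    by (rule smooth_form1_log_norm_form[OF smooth_fibre_theta[OF th] hdot_fibre_theta_nonzero[OF th k2]])
  have B: "smooth_form1 ?B"
    by (rule smooth_form1_log_norm_form[OF smooth_base_theta[OF th] hdot_base_theta_nonzero[OF th k2]])
  note FB = smooth_form1_add[OF F B]
  have \<alpha>: "?\<alpha> = ext_d1 (\<lambda>p v. ?F p v + ?B p v)"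
    unfolding KT_pullback_theta_map[OF th k2 e] log_norm_form_theta_coords[OF th k2 e] ..
  have closed: "KT_closed_form2 ?\<alpha>"
    unfolding KT_closed_form2_def KT_form2_def
    using KT_pullback_theta_map_invariant[OF th k2 e] smooth_form2_ext_d1[OF FB, folded \<alpha>]
      ext_d2_ext_d1[OF FB, folded \<alpha>] by blast
  have "\<exists>v. ?\<alpha> p u v \<noteq> 0" if "u \<noteq> 0" for p u
    using theta_form_nondegenerate[OF th k that, of p] unfolding \<alpha> ext_d1_add[OF F B] .
  moreover have "?\<alpha> p u v - real k * omega_KT p u v = ext_d1 (theta_primitive k \<theta>) p u v" for p u v
    using ext_d1_add[OF FB smooth_form1_KT_correction, of "real k" p u v]
    unfolding \<alpha> ext_d1_KT_correction theta_primitive_def[abs_def] by simp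
  ultimately show ?thesis
    using closed KT_closed_form2_omega_KT KT_form1_theta_primitive[OF th k2]
    unfolding KT_symplectic_def KT_cohomologous_def by blast
qed

end
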